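(* Fix $\beta\ge1$. Let $\{X_i\}_{i\ge1}$ be a sequence of independent random variables in a sub-linear expectation space $(\Omega,\mathscr H,\mathbb E)$ with $\mathbb E[X_i]=\mathbb E[-X_i]=0$, $\overline\sigma_i:=\sqrt{\mathbb E[X_i^2]}$, $\underline\sigma_i:=\sqrt{-\mathbb E[-X_i^2]}$, $\overline\sigma_i/\underline\sigma_i=\beta$ for all $i$, and $0<\inf_i\underline\sigma_i^2\le\sup_i\overline\sigma_i^2<\infty$. Put $S_n=\sum_{i=1}^nX_i$, $\sigma_i=(\underline\sigma_i+\overline\sigma_i)/2$, $B_n=\sqrt{\sum_{i=1}^n\sigma_i^2}$, $W_n=S_n/B_n$. Assume condition (A) below holds for $(\Omega,\mathscr H,\mathbb E)$ and $(\widetilde\Omega,\widetilde{\mathscr H},\widetilde{\mathbb E})$, and let $\alpha\in(0,1)$ be the constant from Song's theorem described in the context. If $\sup_{i\ge1}\mathbb E[|X_i|^{2+\alpha}]<\infty$, then $$\nu\Big(\lim_{n\to\infty}\frac{1}{\log n}\sum_{k\le n}\frac1k f(W_k)=\widetilde{\mathbb E}[f(\xi)]\ \text{ for every } f\in\mathcal H\Big)=1,$$ where $\xi$ is $G$-normally distributed under $\widetilde{\mathbb E}$ with $\sqrt{\widetilde{\mathbb E}[\xi^2]}=\frac{2\beta}{1+\beta}$ and $\sqrt{-\widetilde{\mathbb E}[-\xi^2]}=\frac{2}{1+\beta}$.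
   Context: Sub-linear expectation space $(\Omega,\mathscr H,\mathbb E)$: $(\Omega,\mathcal F)$ a measurable space, $\mathscr H$ a linear space of real measurable functions closed under $(X_1,\dots,X_n)\mapsto\varphi(X_1,\dots,X_n)$ for $\varphi\in C_{b,Lip}(\mathbb R^n)$ (bounded Lipschitz functions), and $\mathbb E:\mathscr H\to\mathbb R$ monotone, constant preserving, sub-additive and positively homogeneous; it is assumed $\mathbb E[X]=\sup_{P\in\mathcal P}E_P[X]$ for a family $\mathcal P$ of $\sigma$-additive probability measures, and $\nu(A)=\inf_{P\in\mathcal P}P(A)$. $(\widetilde\Omega,\widetilde{\mathscr H},\widetilde{\mathbb E})$ is another sub-linear expectation space. Independence: $Y\in\mathscr H^n$ is independent of $X\in\mathscr H^m$ if $\mathbb E[\varphi(X,Y)]=\mathbb E\big[\mathbb E[\varphi(x,Y)]|_{x=X}\big]$ for all $\varphi\in C_{b,Lip}(\mathbb R^{m+n})$ (whenever the relevant quantities are finite); $\{X_n\}$ is independent if $X_{n+1}$ is independent of $(X_1,\dots,X_n)$ for every $n$. Condition (A): for every $X\in\mathscr H$ (resp. $\widetilde{\mathscr H}$) and every sequence $f_n\in C_{b,Lip}(\mathbb R)$ with $f_n\downarrow0$, $\mathbb E[f_n(X)]\downarrow0$ (resp. $\widetilde{\mathbb E}[f_n(X)]\downarrow0$). $G$-normal distribution: $\xi$ is $G$-normal under $\widetilde{\mathbb E}$ if for each $f\in C_{b,Lip}(\mathbb R)$, $u(t,x)=\widetilde{\mathbb E}[f(x+\sqrt t\,\xi)]$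 is the unique viscosity solution of $\partial_tu-G(\partial_{xx}u)=0$ on $(0,\infty)\times\mathbb R$, $u(0,x)=f(x)$, where $G(a)=\frac12\widetilde{\mathbb E}[a\xi^2]$. $\mathcal H:=\{f\in C_{b,Lip}(\mathbb R):\widetilde{\mathbb E}[f(\xi)]=-\widetilde{\mathbb E}[-f(\xi)]\}$. Song's theorem (cited): there exist $\alpha\in(0,1)$ depending on $\beta$ and $C_{\alpha,\beta}>0$ such that for every sequence as in the claim and every $n\ge1$, $\sup_{|f|_{Lip}\le1}\big|\mathbb E[f(W_n)]-\widetilde{\mathbb E}[f(\xi)]\big|\le C_{\alpha,\beta}\sup_{1\le i\le n}\Big\{\frac{\mathbb E[|X_i|^{2+\alpha}]}{\sigma_i^{2+\alpha}}\big(\frac{\sigma_i}{B_n}\big)^{\alpha}\Big\}$, with $\xi$ as in the claim. The $\alpha$ in the claim is this constant. *)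

theory Defs
  imports "HOL-Probability.Probability"
begin

text \<open>A function of the coordinates in the finite index set I (a function on R^I),
  bounded and Lipschitz w.r.t. the Euclidean norm on those coordinates.\<close>
definition bl_lip :: "nat set \<Rightarrow> ((nat \<Rightarrow> real) \<Rightarrow> real) \<Rightarrow> bool" where
  "bl_lip I \<phi> \<longleftrightarrow> (\<exists>B. \<forall>x. \<bar>\<phi> x\<bar> \<le> B) \<and>
     (\<exists>L. \<forall>x y. \<bar>\<phi> x - \<phi> y\<bar> \<le> L * sqrt (\<Sum>i\<in>I. (x i - y i)\<^sup>2))"

definition cbl :: "(real \<Rightarrow> real) \<Rightarrow> bool" where
  "cbl f \<longleftrightarrow> (\<exists>B. \<forall>x. \<bar>f x\<bar> \<le> B) \<and> (\<exists>L. \<forall>x y. \<bar>f x - f y\<bar> \<le> L * \<bar>x - y\<bar>)"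

definition lip1 :: "(real \<Rightarrow> real) \<Rightarrow> bool" where
  "lip1 f \<longleftrightarrow> (\<forall>x y. \<bar>f x - f y\<bar> \<le> \<bar>x - y\<bar>)"

definition upper_exp :: "'a measure set \<Rightarrow> ('a \<Rightarrow> real) \<Rightarrow> real" where
  "upper_exp Ps X = (SUP P\<in>Ps. \<integral>\<omega>. X \<omega> \<partial>P)"

definition upper_finite :: "'a measure set \<Rightarrow> ('a \<Rightarrow> real) \<Rightarrow> bool" where
  "upper_finite Ps X \<longleftrightarrow> (\<forall>P\<in>Ps. integrable P X) \<and> bdd_above ((\<lambda>P. \<integral>\<omega>. X \<omega> \<partial>P) ` Ps)"

definition lower_cap :: "'a measure set \<Rightarrow> 'a set \<Rightarrow> real" where
  "lower_cap Ps A = (INF P\<in>Ps. measure P A)"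

text \<open>(Omega, H, E) is a sub-linear expectation space on the measurable space M with
  E[X] = sup_{P in Ps} E_P[X] on H.\<close>
definition sublin_space :: "'a measure \<Rightarrow> ('a \<Rightarrow> real) set \<Rightarrow> 'a measure set \<Rightarrow> bool" where
  "sublin_space M H Ps \<longleftrightarrow>
     Ps \<noteq> {} \<and> (\<forall>P\<in>Ps. prob_space P \<and> sets P = sets M) \<and>
     H \<subseteq> borel_measurable M \<and>
     (\<forall>X\<in>H. \<forall>Y\<in>H. (\<lambda>\<omega>. X \<omega> + Y \<omega>) \<in> H) \<and>
     (\<forall>X\<in>H. \<forall>c. (\<lambda>\<omega>. c * X \<omega>) \<in> H) \<and>
     (\<forall>I X \<phi>. finite I \<and> (\<forall>i\<in>I. X i \<in> H) \<and> bl_lip I \<phi> \<longrightarrow> (\<lambda>\<omega>. \<phi> (\<lambda>i. X i \<omega>)) \<in> H) \<and>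
     (\<forall>X\<in>H. upper_finite Ps X)"

text \<open>X_{n+1} is independent of (X_1,...,X_n) for every n (indices start at 1).\<close>
definition indep_seq :: "'a measure set \<Rightarrow> (nat \<Rightarrow> 'a \<Rightarrow> real) \<Rightarrow> bool" where
  "indep_seq Ps X \<longleftrightarrow> (\<forall>n \<phi>. bl_lip {1..Suc n} \<phi> \<longrightarrow>
     upper_exp Ps (\<lambda>\<omega>. \<phi> (\<lambda>i. X i \<omega>)) =
     upper_exp Ps (\<lambda>\<omega>. upper_exp Ps (\<lambda>\<omega>'. \<phi> (\<lambda>i. if i = Suc n then X (Suc n) \<omega>' else X i \<omega>))))"

definition cond_A :: "('a \<Rightarrow> real) set \<Rightarrow> 'a measure set \<Rightarrow> bool" where
  "cond_A H Ps \<longleftrightarrow> (\<forall>X\<in>H. \<forall>f :: nat \<Rightarrow> real \<Rightarrow> real.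
     (\<forall>n. cbl (f n)) \<and> (\<forall>x. decseq (\<lambda>n. f n x) \<and> (\<lambda>n. f n x) \<longlonglongrightarrow> 0) \<longrightarrow>
     decseq (\<lambda>n. upper_exp Ps (\<lambda>\<omega>. f n (X \<omega>))) \<and> (\<lambda>n. upper_exp Ps (\<lambda>\<omega>. f n (X \<omega>))) \<longlonglongrightarrow> 0)"

definition c12 :: "(real \<Rightarrow> real \<Rightarrow> real) \<Rightarrow> (real \<Rightarrow> real \<Rightarrow> real) \<Rightarrow> (real \<Rightarrow> real \<Rightarrow> real)
    \<Rightarrow> (real \<Rightarrow> real \<Rightarrow> real) \<Rightarrow> bool" where
  "c12 \<phi> \<phi>t \<phi>x \<phi>xx \<longleftrightarrow>
     (\<forall>t x. ((\<lambda>s. \<phi> s x) has_real_derivative \<phi>t t x) (at t)) \<and>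
     (\<forall>t x. ((\<lambda>y. \<phi> t y) has_real_derivative \<phi>x t x) (at x)) \<and>
     (\<forall>t x. ((\<lambda>y. \<phi>x t y) has_real_derivative \<phi>xx t x) (at x)) \<and>
     continuous_on UNIV (\<lambda>(t, x). \<phi> t x) \<and>
     continuous_on UNIV (\<lambda>(t, x). \<phi>t t x) \<and>
     continuous_on UNIV (\<lambda>(t, x). \<phi>x t x) \<and>
     continuous_on UNIV (\<lambda>(t, x). \<phi>xx t x)"

definition visc_sol :: "(real \<Rightarrow> real) \<Rightarrow> (real \<Rightarrow> real) \<Rightarrow> (real \<Rightarrow> real \<Rightarrow> real) \<Rightarrow> bool" where
  "visc_sol G f u \<longleftrightarrow>
     continuous_on ({0..} \<times> UNIV) (\<lambda>(t, x). u t x) \<and> (\<forall>x. u 0 x = f x) \<and>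
     (\<forall>t x \<phi> \<phi>t \<phi>x \<phi>xx. t > 0 \<and> c12 \<phi> \<phi>t \<phi>x \<phi>xx \<and> \<phi> t x = u t x \<and>
        (\<exists>e>0. \<forall>s y. \<bar>s - t\<bar> < e \<and> \<bar>y - x\<bar> < e \<longrightarrow> u s y \<le> \<phi> s y)
        \<longrightarrow> \<phi>t t x - G (\<phi>xx t x) \<le> 0) \<and>
     (\<forall>t x \<phi> \<phi>t \<phi>x \<phi>xx. t > 0 \<and> c12 \<phi> \<phi>t \<phi>x \<phi>xx \<and> \<phi> t x = u t x \<and>
        (\<exists>e>0. \<forall>s y. \<bar>s - t\<bar> < e \<and> \<bar>y - x\<bar> < e \<longrightarrow> u s y \<ge> \<phi> s y)
        \<longrightarrow> \<phi>t t x - G (\<phi>xx t x) \<ge> 0)"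

definition G_normal :: "'b measure set \<Rightarrow> ('b \<Rightarrow> real) \<Rightarrow> bool" where
  "G_normal Ps \<xi> \<longleftrightarrow> upper_finite Ps (\<lambda>\<omega>. (\<xi> \<omega>)\<^sup>2) \<and>
     (\<forall>f. cbl f \<longrightarrow>
       (let u = (\<lambda>t x. upper_exp Ps (\<lambda>\<omega>. f (x + sqrt t * \<xi> \<omega>)));
            G = (\<lambda>a. upper_exp Ps (\<lambda>\<omega>. a * (\<xi> \<omega>)\<^sup>2) / 2)
        in visc_sol G f u \<and>
           (\<forall>v. visc_sol G f v \<and> (\<exists>B. \<forall>t\<ge>0. \<forall>x. \<bar>v t x\<bar> \<le> B) \<longrightarrow>
                (\<forall>t\<ge>0. \<forall>x. v t x = u t x))))"

definition Hset :: "'b measure set \<Rightarrow> ('b \<Rightarrow> real) \<Rightarrow> (real \<Rightarrow> real) set" where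
  "Hset Ps \<xi> = {f. cbl f \<and> upper_exp Ps (\<lambda>\<omega>. f (\<xi> \<omega>)) = - upper_exp Ps (\<lambda>\<omega>. - f (\<xi> \<omega>))}"

definition sig_up :: "'a measure set \<Rightarrow> (nat \<Rightarrow> 'a \<Rightarrow> real) \<Rightarrow> nat \<Rightarrow> real" where
  "sig_up Ps X i = sqrt (upper_exp Ps (\<lambda>\<omega>. (X i \<omega>)\<^sup>2))"

definition sig_low :: "'a measure set \<Rightarrow> (nat \<Rightarrow> 'a \<Rightarrow> real) \<Rightarrow> nat \<Rightarrow> real" where
  "sig_low Ps X i = sqrt (- upper_exp Ps (\<lambda>\<omega>. - (X i \<omega>)\<^sup>2))"

definition sig :: "'a measure set \<Rightarrow> (nat \<Rightarrow> 'a \<Rightarrow> real) \<Rightarrow> nat \<Rightarrow> real" where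
  "sig Ps X i = (sig_low Ps X i + sig_up Ps X i) / 2"

definition Bn :: "'a measure set \<Rightarrow> (nat \<Rightarrow> 'a \<Rightarrow> real) \<Rightarrow> nat \<Rightarrow> real" where
  "Bn Ps X n = sqrt (\<Sum>i=1..n. (sig Ps X i)\<^sup>2)"

definition Wn :: "'a measure set \<Rightarrow> (nat \<Rightarrow> 'a \<Rightarrow> real) \<Rightarrow> nat \<Rightarrow> 'a \<Rightarrow> real" where
  "Wn Ps X n \<omega> = (\<Sum>i=1..n. X i \<omega>) / Bn Ps X n"

text \<open>The standing hypotheses on the sequence X_1, X_2, ... (index 0 unused).\<close>
definition admissible :: "('a \<Rightarrow> real) set \<Rightarrow> 'a measure set \<Rightarrow> real \<Rightarrow> (nat \<Rightarrow> 'a \<Rightarrow> real) \<Rightarrow> bool" where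
  "admissible H Ps \<beta> X \<longleftrightarrow>
     (\<forall>i\<ge>1. X i \<in> H) \<and> indep_seq Ps X \<and>
     (\<forall>i\<ge>1. upper_exp Ps (X i) = 0 \<and> upper_exp Ps (\<lambda>\<omega>. - X i \<omega>) = 0) \<and>
     (\<forall>i\<ge>1. upper_finite Ps (\<lambda>\<omega>. (X i \<omega>)\<^sup>2)) \<and>
     (\<forall>i\<ge>1. sig_up Ps X i / sig_low Ps X i = \<beta>) \<and>
     (\<exists>c>0. \<forall>i\<ge>1. c \<le> (sig_low Ps X i)\<^sup>2) \<and>
     (\<exists>K. \<forall>i\<ge>1. (sig_up Ps X i)\<^sup>2 \<le> K)"

definition moment_bdd :: "'a measure set \<Rightarrow> (nat \<Rightarrow> 'a \<Rightarrow> real) \<Rightarrow> real \<Rightarrow> bool" where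
  "moment_bdd Ps X p \<longleftrightarrow> (\<forall>i\<ge>1. upper_finite Ps (\<lambda>\<omega>. \<bar>X i \<omega>\<bar> powr p)) \<and>
     (\<exists>K. \<forall>i\<ge>1. upper_exp Ps (\<lambda>\<omega>. \<bar>X i \<omega>\<bar> powr p) \<le> K)"

text \<open>alpha is a constant for which Song's Berry-Esseen bound holds (for all admissible
  sequences with finite (2+alpha)-moments in the space, with this xi).\<close>
definition song_bound :: "('a \<Rightarrow> real) set \<Rightarrow> 'a measure set \<Rightarrow> 'b measure set \<Rightarrow> ('b \<Rightarrow> real)
    \<Rightarrow> real \<Rightarrow> real \<Rightarrow> bool" where
  "song_bound H Ps Ps' \<xi> \<beta> \<alpha> \<longleftrightarrow> (\<exists>C>0. \<forall>Y. admissible H Ps \<beta> Y \<and> moment_bdd Ps Y (2 + \<alpha>) \<longrightarrow>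
     (\<forall>n\<ge>1. \<forall>f. cbl f \<and> lip1 f \<longrightarrow>
        \<bar>upper_exp Ps (\<lambda>\<omega>. f (Wn Ps Y n \<omega>)) - upper_exp Ps' (\<lambda>\<omega>. f (\<xi> \<omega>))\<bar>
        \<le> C * (MAX i\<in>{1..n}. upper_exp Ps (\<lambda>\<omega>. \<bar>Y i \<omega>\<bar> powr (2 + \<alpha>)) / sig Ps Y i powr (2 + \<alpha>)
                 * (sig Ps Y i / Bn Ps Y n) powr \<alpha>)))"

end

theory Submission
  imports Defs "HOL-Real_Asymp.Real_Asymp"
begin

text \<open>
  Fix one \<open>P\<close> in the representing family, a bounded Lipschitz \<open>h\<close> and
  \<open>g = h - E'[h(\<xi>)]\<close>, and let \<open>R\<^sub>n = \<Sum>\<^bsub>k\<le>n\<^esub> g(W\<^sub>k)/k\<close>. Independence together with Song's rate bounds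
  \<open>E\<^sub>P[G g(W\<^sub>n)]\<close> from above by a multiple of \<open>(m/n)\<close> to the power \<open>\<alpha>/2\<close>, for nonnegative
  functions \<open>G\<close> of \<open>X\<^sub>1, \<dots>, X\<^sub>m\<close>. This suffices to
  control the second moment of the positive part of \<open>R\<^sub>n\<close>, and Borel-Cantelli along
  \<open>n = 2^(j^3)\<close> gives that the upper limit of the logarithmic averages of \<open>h(W\<^sub>k)\<close> is
  \<open>P\<close>-almost surely at most \<open>E'[h(\<xi>)]\<close>, for every bounded Lipschitz \<open>h\<close>. For \<open>f\<close> in the symmetric class
  one applies this to \<open>f\<close> and \<open>-f\<close>. A single exceptional set is obtained by bounding \<open>f\<close> from
  above by a countable family of piecewise linear functions with almost the same
  upper expectation at \<open>\<xi>\<close>. The first moments of \<open>W\<^sub>n\<close> that the argument needs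
  also come from Song's bound, applied to \<open>min |x| N\<close>.
\<close>

section \<open>Bounded Lipschitz functions\<close>

lemma cblI:
  assumes "\<And>x. \<bar>f x\<bar> \<le> B" and "\<And>x y. \<bar>f x - f y\<bar> \<le> L * \<bar>x - y\<bar>"
  shows "cbl f"
  using assms unfolding cbl_def by blast

text \<open>Both constants are made strictly positive because later steps divide by the Lipschitz
  constant.\<close>

lemma cblE:
  assumes "cbl f"
  obtains B L where "B > 0" "L > 0" "\<And>x. \<bar>f x\<bar> \<le> B" "\<And>x y. \<bar>f x - f y\<bar> \<le> L * \<bar>x - y\<bar>"
proof -
  obtain B L where BL: "\<And>x. \<bar>f x\<bar> \<le> B" "\<And>x y. \<bar>f x - f y\<bar> \<le> L * \<bar>x - y\<bar>"
    using assms unfolding cbl_def by blast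
  show thesis
  proof (rule that[of "\<bar>B\<bar> + 1" "\<bar>L\<bar> + 1"])
    show "\<bar>f x\<bar> \<le> \<bar>B\<bar> + 1" for x
      using BL(1)[of x] by linarith
    show "\<bar>f x - f y\<bar> \<le> (\<bar>L\<bar> + 1) * \<bar>x - y\<bar>" for x y
      by (rule order_trans[OF BL(2)]) (intro mult_right_mono, auto)
  qed auto
qed

lemma cbl_measurable [measurable]:
  assumes "cbl f"
  shows "f \<in> borel_measurable borel"
proof -
  obtain B L where L: "L > 0" "\<And>x y. \<bar>f x - f y\<bar> \<le> L * \<bar>x - y\<bar>"
    using cblE[OF assms] by metis
  have "L-lipschitz_on UNIV f"
    using L by (intro lipschitz_onI) (auto simp: dist_real_def)
  then show ?thesis
    by (intro borel_measurable_continuous_onI lipschitz_on_continuous_on)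
qed

lemma cbl_uminus: "cbl f \<Longrightarrow> cbl (\<lambda>x. - f x)"
  unfolding cbl_def by (simp add: abs_minus_commute)

lemma cbl_diff_const:
  assumes "cbl f"
  shows "cbl (\<lambda>x. f x - c)"
proof -
  obtain B L where "\<And>x. \<bar>f x\<bar> \<le> B" "\<And>x y. \<bar>f x - f y\<bar> \<le> L * \<bar>x - y\<bar>"
    using cblE[OF assms] by metis
  then show ?thesis
    by (intro cblI[of _ "B + \<bar>c\<bar>" L]) (auto intro: order_trans[OF abs_triangle_ineq4])
qed

lemma cbl_scale_arg:
  assumes "cbl f"
  shows "cbl (\<lambda>x. f (x / c))"
proof -
  obtain B L where BL: "\<And>x. \<bar>f x\<bar> \<le> B" "\<And>x y. \<bar>f x - f y\<bar> \<le> L * \<bar>x - y\<bar>"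
    using cblE[OF assms] by metis
  have "\<bar>f (x / c) - f (y / c)\<bar> \<le> (L / \<bar>c\<bar>) * \<bar>x - y\<bar>" for x y
    using BL(2)[of "x / c" "y / c"] by (simp add: diff_divide_distrib[symmetric])
  with BL(1) show ?thesis
    by (intro cblI)
qed

lemma cbl_min_abs: "cbl (\<lambda>x. min \<bar>x\<bar> N)"
proof (rule cblI[of _ "\<bar>N\<bar>" 1])
  show "\<bar>min \<bar>x\<bar> N\<bar> \<le> \<bar>N\<bar>" for x
    by (cases "\<bar>x\<bar> \<le> N") (auto simp: min_def)
  show "\<bar>min \<bar>x\<bar> N - min \<bar>y\<bar> N\<bar> \<le> 1 * \<bar>x - y\<bar>" for x y
    unfolding min_def by auto
qed

lemma bl_lipI:
  assumes "\<And>x. \<bar>\<phi> x\<bar> \<le> B" and "\<And>x y. \<bar>\<phi> x - \<phi> y\<bar> \<le> L * sqrt (\<Sum>i\<in>I. (x i - y i)\<^sup>2)"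
  shows "bl_lip I \<phi>"
  using assms unfolding bl_lip_def by blast

lemma bl_lipE:
  assumes "bl_lip I \<phi>"
  obtains B L where "B > 0" "L > 0" "\<And>x. \<bar>\<phi> x\<bar> \<le> B"
    "\<And>x y. \<bar>\<phi> x - \<phi> y\<bar> \<le> L * sqrt (\<Sum>i\<in>I. (x i - y i)\<^sup>2)"
proof -
  obtain B L where BL: "\<And>x. \<bar>\<phi> x\<bar> \<le> B"
    "\<And>x y. \<bar>\<phi> x - \<phi> y\<bar> \<le> L * sqrt (\<Sum>i\<in>I. (x i - y i)\<^sup>2)"
    using assms unfolding bl_lip_def by blast
  show thesis
  proof (rule that[of "\<bar>B\<bar> + 1" "\<bar>L\<bar> + 1"])
    show "\<bar>\<phi> x\<bar> \<le> \<bar>B\<bar> + 1" for x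
      using BL(1)[of x] by linarith
    show "\<bar>\<phi> x - \<phi> y\<bar> \<le> (\<bar>L\<bar> + 1) * sqrt (\<Sum>i\<in>I. (x i - y i)\<^sup>2)" for x y
      by (rule order_trans[OF BL(2)]) (intro mult_right_mono, auto intro: sum_nonneg)
  qed auto
qed

lemma bl_lip_mono:
  assumes "bl_lip I \<phi>" and "I \<subseteq> J" and "finite J"
  shows "bl_lip J \<phi>"
proof -
  obtain B L where BL: "L > 0" "\<And>x. \<bar>\<phi> x\<bar> \<le> B"
    "\<And>x y. \<bar>\<phi> x - \<phi> y\<bar> \<le> L * sqrt (\<Sum>i\<in>I. (x i - y i)\<^sup>2)"
    using bl_lipE[OF assms(1)] by metis
  have "L * sqrt (\<Sum>i\<in>I. (x i - y i)\<^sup>2) \<le> L * sqrt (\<Sum>i\<in>J. (x i - y i)\<^sup>2)" for x y :: "nat \<Rightarrow> real"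
    using BL(1) assms(2,3) by (intro mult_left_mono real_sqrt_le_mono sum_mono2) auto
  then show ?thesis
    by (intro bl_lipI[of _ B L] BL(2) order_trans[OF BL(3)])
qed

text \<open>The Lipschitz bound vanishes when the coordinates in \<open>I\<close> agree. This is how
  a weight on \<open>{1..m}\<close> ignores the later coordinates over which independence
  integrates.\<close>

lemma bl_lip_cong:
  assumes "bl_lip I \<phi>" and "\<And>i. i \<in> I \<Longrightarrow> x i = y i"
  shows "\<phi> x = \<phi> y"
proof -
  obtain B L where "\<And>x y. \<bar>\<phi> x - \<phi> y\<bar> \<le> L * sqrt (\<Sum>i\<in>I. (x i - y i)\<^sup>2)"
    using bl_lipE[OF assms(1)] by metis
  from this[of x y] show ?thesis
    using assms(2) by simp
qed

lemma bl_lip_const: "bl_lip I (\<lambda>x. c)"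
  by (rule bl_lipI[of _ "\<bar>c\<bar>" 0]) auto

lemma bl_lip_add:
  assumes "bl_lip I \<phi>" and "bl_lip I \<psi>"
  shows "bl_lip I (\<lambda>x. \<phi> x + \<psi> x)"
proof -
  obtain B L where 1: "\<And>x. \<bar>\<phi> x\<bar> \<le> B"
    "\<And>x y. \<bar>\<phi> x - \<phi> y\<bar> \<le> L * sqrt (\<Sum>i\<in>I. (x i - y i)\<^sup>2)"
    using bl_lipE[OF assms(1)] by metis
  obtain B' L' where 2: "\<And>x. \<bar>\<psi> x\<bar> \<le> B'"
    "\<And>x y. \<bar>\<psi> x - \<psi> y\<bar> \<le> L' * sqrt (\<Sum>i\<in>I. (x i - y i)\<^sup>2)"
    using bl_lipE[OF assms(2)] by metis
  show ?thesis
  proof (rule bl_lipI[of _ "B + B'" "L + L'"])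
    show "\<bar>\<phi> x + \<psi> x\<bar> \<le> B + B'" for x
      using 1(1)[of x] 2(1)[of x] by linarith
    show "\<bar>\<phi> x + \<psi> x - (\<phi> y + \<psi> y)\<bar> \<le> (L + L') * sqrt (\<Sum>i\<in>I. (x i - y i)\<^sup>2)" for x y
      using 1(2)[of x y] 2(2)[of x y] unfolding distrib_right by linarith
  qed
qed

lemma bl_lip_mult:
  assumes "bl_lip I \<phi>" and "bl_lip I \<psi>"
  shows "bl_lip I (\<lambda>x. \<phi> x * \<psi> x)"
proof -
  obtain B L where 1: "B > 0" "\<And>x. \<bar>\<phi> x\<bar> \<le> B"
    "\<And>x y. \<bar>\<phi> x - \<phi> y\<bar> \<le> L * sqrt (\<Sum>i\<in>I. (x i - y i)\<^sup>2)"
    using bl_lipE[OF assms(1)] by metis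
  obtain B' L' where 2: "B' > 0" "\<And>x. \<bar>\<psi> x\<bar> \<le> B'"
    "\<And>x y. \<bar>\<psi> x - \<psi> y\<bar> \<le> L' * sqrt (\<Sum>i\<in>I. (x i - y i)\<^sup>2)"
    using bl_lipE[OF assms(2)] by metis
  show ?thesis
  proof (rule bl_lipI[of _ "B * B'" "B * L' + B' * L"])
    show "\<bar>\<phi> x * \<psi> x\<bar> \<le> B * B'" for x
      unfolding abs_mult using 1 2 by (intro mult_mono) auto
    fix x y :: "nat \<Rightarrow> real"
    let ?s = "sqrt (\<Sum>i\<in>I. (x i - y i)\<^sup>2)"
    have "\<phi> x * \<psi> x - \<phi> y * \<psi> y = \<phi> x * (\<psi> x - \<psi> y) + \<psi> y * (\<phi> x - \<phi> y)"
      by (simp add: algebra_simps)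
    also have "\<bar>\<dots>\<bar> \<le> \<bar>\<phi> x\<bar> * \<bar>\<psi> x - \<psi> y\<bar> + \<bar>\<psi> y\<bar> * \<bar>\<phi> x - \<phi> y\<bar>"
      by (metis abs_mult abs_triangle_ineq)
    also have "\<dots> \<le> B * (L' * ?s) + B' * (L * ?s)"
      using 1 2 by (intro add_mono mult_mono) auto
    finally show "\<bar>\<phi> x * \<psi> x - \<phi> y * \<psi> y\<bar> \<le> (B * L' + B' * L) * ?s"
      by (simp add: algebra_simps)
  qed
qed

lemma bl_lip_sum:
  assumes "\<And>k. k \<in> A \<Longrightarrow> bl_lip I (\<phi> k)"
  shows "bl_lip I (\<lambda>x. \<Sum>k\<in>A. \<phi> k x)"
  using assms
  by (induction A rule: infinite_finite_induct) (auto intro: bl_lip_const bl_lip_add)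

lemma bl_lip_max0:
  assumes "bl_lip I \<phi>"
  shows "bl_lip I (\<lambda>x. max 0 (\<phi> x))"
proof -
  obtain B L where 1: "\<And>x. \<bar>\<phi> x\<bar> \<le> B"
    "\<And>x y. \<bar>\<phi> x - \<phi> y\<bar> \<le> L * sqrt (\<Sum>i\<in>I. (x i - y i)\<^sup>2)"
    using bl_lipE[OF assms(1)] by metis
  have "\<bar>max 0 (\<phi> x)\<bar> \<le> \<bar>\<phi> x\<bar>" "\<bar>max 0 (\<phi> x) - max 0 (\<phi> y)\<bar> \<le> \<bar>\<phi> x - \<phi> y\<bar>" for x y
    by (auto simp: max_def)
  then show ?thesis
    using 1 by (intro bl_lipI[of _ B L]) (blast intro: order_trans)+
qed

lemma bl_lip_comp_sum:
  assumes "cbl f" and "finite I"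
  shows "bl_lip I (\<lambda>x. f (\<Sum>i\<in>I. x i))"
proof -
  obtain B L where 1: "L > 0" "\<And>x. \<bar>f x\<bar> \<le> B" "\<And>x y. \<bar>f x - f y\<bar> \<le> L * \<bar>x - y\<bar>"
    using cblE[OF assms(1)] by metis
  show ?thesis
  proof (rule bl_lipI[of _ B "L * card I"])
    show "\<bar>f (\<Sum>i\<in>I. x i)\<bar> \<le> B" for x
      by (rule 1(2))
    fix x y :: "nat \<Rightarrow> real"
    let ?s = "sqrt (\<Sum>i\<in>I. (x i - y i)\<^sup>2)"
    \<comment> \<open>Each coordinate difference is at most the Euclidean norm. The resulting factor
      \<open>card I\<close> is crude, but only membership in the class matters.\<close>
    have "\<bar>x i - y i\<bar> \<le> ?s" if "i \<in> I" for i
      using member_le_sum[OF that, of "\<lambda>i. (x i - y i)\<^sup>2"] assms(2)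
      by (intro real_le_rsqrt) auto
    then have "\<bar>\<Sum>i\<in>I. x i - y i\<bar> \<le> card I * ?s"
      by (intro order_trans[OF sum_abs] sum_bounded_above)
    then have "L * \<bar>(\<Sum>i\<in>I. x i) - (\<Sum>i\<in>I. y i)\<bar> \<le> L * (card I * ?s)"
      using 1(1) by (intro mult_left_mono) (auto simp: sum_subtractf)
    with 1(3)[of "\<Sum>i\<in>I. x i" "\<Sum>i\<in>I. y i"]
    show "\<bar>f (\<Sum>i\<in>I. x i) - f (\<Sum>i\<in>I. y i)\<bar> \<le> (L * card I) * ?s"
      by (simp add: mult.assoc)
  qed
qed

section \<open>Upper expectations of bounded random variables\<close>

locale sublinear_expectation =
  fixes M :: "'a measure" and H :: "('a \<Rightarrow> real) set" and Ps :: "'a measure set"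
  assumes sublin_space: "sublin_space M H Ps"
begin

abbreviation "E \<equiv> upper_exp Ps"

text \<open>A class closed under products, which \<open>H\<close> is not assumed to be, and on which
  \<open>upper_finite\<close> is automatic; products of weights and test functions live
  here.\<close>

definition bounded_rv :: "('a \<Rightarrow> real) \<Rightarrow> bool" where
  "bounded_rv X \<longleftrightarrow> X \<in> borel_measurable M \<and> (\<exists>B. \<forall>\<omega>. \<bar>X \<omega>\<bar> \<le> B)"

lemma Ps_nonempty: "Ps \<noteq> {}"
  and prob_space_Ps: "P \<in> Ps \<Longrightarrow> prob_space P"
  and sets_Ps: "P \<in> Ps \<Longrightarrow> sets P = sets M"
  and H_measurable: "X \<in> H \<Longrightarrow> X \<in> borel_measurable M"
  using sublin_space unfolding sublin_space_def by auto

lemma H_bl_lip: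
  "finite I \<Longrightarrow> (\<And>i. i \<in> I \<Longrightarrow> Y i \<in> H) \<Longrightarrow> bl_lip I \<phi> \<Longrightarrow> (\<lambda>\<omega>. \<phi> (\<lambda>i. Y i \<omega>)) \<in> H"
  using sublin_space unfolding sublin_space_def by meson

lemma space_Ps: "P \<in> Ps \<Longrightarrow> space P = space M"
  by (metis sets_Ps sets_eq_imp_space_eq)

lemma measurable_Ps: "P \<in> Ps \<Longrightarrow> borel_measurable P = borel_measurable M"
  by (metis measurable_cong_sets sets_Ps)

lemma bounded_rv_measurable: "bounded_rv X \<Longrightarrow> X \<in> borel_measurable M"
  unfolding bounded_rv_def by auto

lemma bounded_rv_const: "bounded_rv (\<lambda>\<omega>. c)"
  unfolding bounded_rv_def by auto

lemma bounded_rv_add: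
  assumes "bounded_rv X" and "bounded_rv Y"
  shows "bounded_rv (\<lambda>\<omega>. X \<omega> + Y \<omega>)"
proof -
  obtain B B' where "\<forall>\<omega>. \<bar>X \<omega>\<bar> \<le> B" "\<forall>\<omega>. \<bar>Y \<omega>\<bar> \<le> B'"
    using assms unfolding bounded_rv_def by auto
  then have "\<forall>\<omega>. \<bar>X \<omega> + Y \<omega>\<bar> \<le> B + B'"
    by (intro allI order_trans[OF abs_triangle_ineq] add_mono) auto
  then show ?thesis
    using assms unfolding bounded_rv_def by auto
qed

lemma bounded_rv_mult:
  assumes "bounded_rv X" and "bounded_rv Y"
  shows "bounded_rv (\<lambda>\<omega>. X \<omega> * Y \<omega>)"
proof -
  obtain B B' where "\<forall>\<omega>. \<bar>X \<omega>\<bar> \<le> B" "\<forall>\<omega>. \<bar>Y \<omega>\<bar> \<le> B'"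
    using assms unfolding bounded_rv_def by auto
  then have "\<forall>\<omega>. \<bar>X \<omega> * Y \<omega>\<bar> \<le> B * B'"
    unfolding abs_mult by (intro allI mult_mono) (auto intro: order_trans[OF abs_ge_zero])
  then show ?thesis
    using assms unfolding bounded_rv_def by auto
qed

lemma bounded_rv_integrable:
  assumes "bounded_rv X" and "P \<in> Ps"
  shows "integrable P X"
proof -
  interpret prob_space P by (rule prob_space_Ps[OF assms(2)])
  obtain B where "\<forall>\<omega>. \<bar>X \<omega>\<bar> \<le> B"
    using assms(1) unfolding bounded_rv_def by auto
  then show ?thesis
    using assms by (intro integrable_const_bound[of _ B]) (auto simp: measurable_Ps bounded_rv_def)
qed

lemma upper_finite_bounded:
  assumes "bounded_rv X"
  shows "upper_finite Ps X"
proof -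
  obtain B where B: "\<forall>\<omega>. \<bar>X \<omega>\<bar> \<le> B"
    using assms(1) unfolding bounded_rv_def by auto
  have "(\<integral>\<omega>. X \<omega> \<partial>P) \<le> B" if "P \<in> Ps" for P
  proof -
    interpret prob_space P by (rule prob_space_Ps[OF that])
    show ?thesis
      using B bounded_rv_integrable[OF assms that] by (intro integral_le_const) (auto simp: abs_le_iff)
  qed
  then show ?thesis
    unfolding upper_finite_def using bounded_rv_integrable[OF assms] by (auto intro!: bdd_aboveI2)
qed

lemma integral_le_upper: "upper_finite Ps X \<Longrightarrow> P \<in> Ps \<Longrightarrow> (\<integral>\<omega>. X \<omega> \<partial>P) \<le> E X"
  unfolding upper_exp_def upper_finite_def by (intro cSUP_upper) auto

lemma upper_leI: "(\<And>P. P \<in> Ps \<Longrightarrow> (\<integral>\<omega>. X \<omega> \<partial>P) \<le> c) \<Longrightarrow> E X \<le> c"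
  unfolding upper_exp_def using Ps_nonempty by (intro cSUP_least)

text \<open>The majorant need only be \<open>upper_finite\<close>, which admits unbounded ones built
  from the square of \<open>\<xi>\<close>.\<close>

lemma upper_mono:
  assumes "bounded_rv X" and "upper_finite Ps Y" and "\<And>\<omega>. X \<omega> \<le> Y \<omega>"
  shows "E X \<le> E Y"
proof (rule upper_leI)
  fix P assume P: "P \<in> Ps"
  have "(\<integral>\<omega>. X \<omega> \<partial>P) \<le> (\<integral>\<omega>. Y \<omega> \<partial>P)"
    using assms P bounded_rv_integrable[OF assms(1) P]
    by (intro integral_mono) (auto simp: upper_finite_def)
  also have "\<dots> \<le> E Y"
    by (rule integral_le_upper[OF assms(2) P])
  finally show "(\<integral>\<omega>. X \<omega> \<partial>P) \<le> E Y" .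
qed

lemma upper_add:
  assumes "upper_finite Ps X" and "upper_finite Ps Y"
  shows "E (\<lambda>\<omega>. X \<omega> + Y \<omega>) \<le> E X + E Y"
proof (rule upper_leI)
  fix P assume P: "P \<in> Ps"
  have "(\<integral>\<omega>. X \<omega> + Y \<omega> \<partial>P) = (\<integral>\<omega>. X \<omega> \<partial>P) + (\<integral>\<omega>. Y \<omega> \<partial>P)"
    using assms P unfolding upper_finite_def by (intro Bochner_Integration.integral_add) auto
  then show "(\<integral>\<omega>. X \<omega> + Y \<omega> \<partial>P) \<le> E X + E Y"
    using integral_le_upper[OF assms(1) P] integral_le_upper[OF assms(2) P] by linarith
qed

lemma upper_const: "E (\<lambda>\<omega>. c) = c"
proof -
  have "(\<integral>\<omega>. c \<partial>P) = c" if "P \<in> Ps" for P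
    using prob_space.prob_space[OF prob_space_Ps[OF that]] by simp
  then have "(\<lambda>P. \<integral>\<omega>. c \<partial>P) ` Ps = {c}"
    using Ps_nonempty by force
  then show ?thesis
    unfolding upper_exp_def by simp
qed

lemma upper_cmult:
  assumes "upper_finite Ps X" and "c \<ge> 0"
  shows "E (\<lambda>\<omega>. c * X \<omega>) = c * E X"
proof (cases "c = 0")
  case True
  then show ?thesis using upper_const by simp
next
  case False
  have "E (\<lambda>\<omega>. c * X \<omega>) = (SUP P\<in>Ps. c * (\<integral>\<omega>. X \<omega> \<partial>P))"
    unfolding upper_exp_def by simp
  also have "\<dots> = c * E X"
    unfolding upper_exp_def
  proof (rule antisym)
    show "(SUP P\<in>Ps. c * (\<integral>\<omega>. X \<omega> \<partial>P)) \<le> c * (SUP P\<in>Ps. (\<integral>\<omega>. X \<omega> \<partial>P))"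
      using assms Ps_nonempty integral_le_upper[OF assms(1)] unfolding upper_exp_def
      by (intro cSUP_least mult_left_mono) auto
    have "(\<integral>\<omega>. X \<omega> \<partial>P) \<le> (SUP P\<in>Ps. c * (\<integral>\<omega>. X \<omega> \<partial>P)) / c" if "P \<in> Ps" for P
    proof -
      have "bdd_above ((\<lambda>P. c * (\<integral>\<omega>. X \<omega> \<partial>P)) ` Ps)"
        using integral_le_upper[OF assms(1)] assms(2)
        by (intro bdd_aboveI2[of _ _ "c * E X"] mult_left_mono)
      from cSUP_upper[OF that this] show ?thesis
        using assms(2) False by (simp add: field_simps)
    qed
    then have "(SUP P\<in>Ps. (\<integral>\<omega>. X \<omega> \<partial>P)) \<le> (SUP P\<in>Ps. c * (\<integral>\<omega>. X \<omega> \<partial>P)) / c"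
      using Ps_nonempty by (intro cSUP_least)
    then show "c * (SUP P\<in>Ps. (\<integral>\<omega>. X \<omega> \<partial>P)) \<le> (SUP P\<in>Ps. c * (\<integral>\<omega>. X \<omega> \<partial>P))"
      using assms(2) False by (simp add: field_simps)
  qed
  finally show ?thesis .
qed

lemma upper_finite_const: "upper_finite Ps (\<lambda>\<omega>. c)"
  by (intro upper_finite_bounded bounded_rv_const)

lemma upper_finite_cmult:
  assumes "upper_finite Ps X" and "c \<ge> 0"
  shows "upper_finite Ps (\<lambda>\<omega>. c * X \<omega>)"
  unfolding upper_finite_def
proof (intro conjI ballI bdd_aboveI2[of _ _ "c * E X"])
  show "integrable P (\<lambda>\<omega>. c * X \<omega>)" if "P \<in> Ps" for P
    using assms that unfolding upper_finite_def by auto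
  show "(\<integral>\<omega>. c * X \<omega> \<partial>P) \<le> c * E X" if "P \<in> Ps" for P
    using integral_le_upper[OF assms(1) that] assms(2) by (simp add: mult_left_mono)
qed

lemma upper_finite_add:
  assumes "upper_finite Ps X" and "upper_finite Ps Y"
  shows "upper_finite Ps (\<lambda>\<omega>. X \<omega> + Y \<omega>)"
  unfolding upper_finite_def
proof (intro conjI ballI bdd_aboveI2[of _ _ "E X + E Y"])
  show "integrable P (\<lambda>\<omega>. X \<omega> + Y \<omega>)" if "P \<in> Ps" for P
    using assms that unfolding upper_finite_def by auto
  show "(\<integral>\<omega>. X \<omega> + Y \<omega> \<partial>P) \<le> E X + E Y" if "P \<in> Ps" for P
    using integral_le_upper[OF assms(1) that] integral_le_upper[OF assms(2) that] assms that
    unfolding upper_finite_def by auto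
qed

lemma upper_nonneg:
  assumes "upper_finite Ps X" and "\<And>\<omega>. 0 \<le> X \<omega>"
  shows "0 \<le> E X"
  using upper_mono[of "\<lambda>_. 0" X] assms upper_const[of 0] by (auto simp: bounded_rv_const)

text \<open>Sub-additivity carries a pointwise one-sided bound over to \<open>E\<close>; used in
  both directions, it preserves Lipschitz constants.\<close>

lemma upper_diff_le:
  assumes "bounded_rv X" and "bounded_rv Y" and "\<And>\<omega>. X \<omega> \<le> Y \<omega> + c"
  shows "E X \<le> E Y + c"
proof -
  have "E X \<le> E (\<lambda>\<omega>. Y \<omega> + c)"
    using assms by (intro upper_mono upper_finite_add upper_finite_const) (auto simp: upper_finite_bounded)
  also have "\<dots> \<le> E Y + E (\<lambda>\<omega>. c)"
    using assms by (intro upper_add upper_finite_const) (auto simp: upper_finite_bounded)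
  finally show ?thesis
    by (simp add: upper_const)
qed

lemma upper_add_const:
  assumes "bounded_rv X"
  shows "E (\<lambda>\<omega>. X \<omega> + c) = E X + c"
proof (rule antisym)
  have b: "bounded_rv (\<lambda>\<omega>. X \<omega> + c)"
    by (intro bounded_rv_add assms bounded_rv_const)
  show "E (\<lambda>\<omega>. X \<omega> + c) \<le> E X + c"
    by (intro upper_diff_le b assms) auto
  show "E X + c \<le> E (\<lambda>\<omega>. X \<omega> + c)"
    using upper_diff_le[OF assms b, of "- c"] by auto
qed

lemma bounded_rv_cbl:
  assumes "cbl f" and "X \<in> borel_measurable M"
  shows "bounded_rv (\<lambda>\<omega>. f (X \<omega>))"
proof -
  obtain B where "\<And>x. \<bar>f x\<bar> \<le> B"
    using assms(1) by (auto simp: cbl_def)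
  moreover have "(\<lambda>\<omega>. f (X \<omega>)) \<in> borel_measurable M"
    using cbl_measurable[OF assms(1)] assms(2) by measurable
  ultimately show ?thesis
    unfolding bounded_rv_def by auto
qed

lemma bounded_rv_bl_lip:
  assumes "finite I" and "\<And>i. i \<in> I \<Longrightarrow> Y i \<in> H" and "bl_lip I \<phi>"
  shows "bounded_rv (\<lambda>\<omega>. \<phi> (\<lambda>i. Y i \<omega>))"
proof -
  obtain B where "\<And>x. \<bar>\<phi> x\<bar> \<le> B"
    using bl_lipE[OF assms(3)] by metis
  moreover have "(\<lambda>\<omega>. \<phi> (\<lambda>i. Y i \<omega>)) \<in> borel_measurable M"
    using H_bl_lip[OF assms] by (intro H_measurable) auto
  ultimately show ?thesis
    unfolding bounded_rv_def by auto
qed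

section \<open>Iterated independence\<close>

text \<open>Integrating out \<open>X\<^sub>n, \<dots>, X\<^bsub>m+1\<^esub>\<close> one at a time leaves a function \<open>u\<close> of the partial
  sum that is independent of the weight \<open>G\<close>. Nonnegativity of \<open>G\<close> is what lets it be pulled out
  of the inner upper expectations.\<close>
lemma integrate_out_increments:
  fixes X :: "nat \<Rightarrow> 'a \<Rightarrow> real"
  assumes X: "\<And>i. i \<ge> 1 \<Longrightarrow> X i \<in> H" and ind: "indep_seq Ps X" and "m \<le> n"
    and "\<And>x. \<bar>h x\<bar> \<le> B" and "\<And>x y. \<bar>h x - h y\<bar> \<le> L * \<bar>x - y\<bar>"
  shows "\<exists>u. (\<forall>x. \<bar>u x\<bar> \<le> B) \<and> (\<forall>x y. \<bar>u x - u y\<bar> \<le> L * \<bar>x - y\<bar>) \<and>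
    (\<forall>G. bl_lip {1..m} G \<and> (\<forall>x. 0 \<le> G x) \<longrightarrow>
      E (\<lambda>\<omega>. G (\<lambda>i. X i \<omega>) * h (\<Sum>i=1..n. X i \<omega>)) =
      E (\<lambda>\<omega>. G (\<lambda>i. X i \<omega>) * u (\<Sum>i=1..m. X i \<omega>)))"
  using assms(3-5)
proof (induction n arbitrary: h rule: dec_induct)
  case base
  then show ?case by blast
next
  case (step n)
  \<comment> \<open>Averaging out the last increment preserves both the bound \<open>B\<close> and
    the Lipschitz constant \<open>L\<close>, so the induction hypothesis applies to
    \<open>h'\<close> with the same constants.\<close>
  define h' where "h' = (\<lambda>s. E (\<lambda>\<omega>. h (s + X (Suc n) \<omega>)))"
  have cbl: "cbl h"
    using step.prems by (rule cblI)
  have meas: "X (Suc n) \<in> borel_measurable M"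
    using X by (intro H_measurable) auto
  have bdd: "bounded_rv (\<lambda>\<omega>. h (s + X (Suc n) \<omega>))" for s
    using meas by (intro bounded_rv_cbl[OF cbl]) auto
  have 1: "\<bar>h' x\<bar> \<le> B" for x
  proof -
    have "h' x \<le> E (\<lambda>_. B)" "E (\<lambda>_. - B) \<le> h' x"
      unfolding h'_def using step.prems(1)
      by (auto intro!: upper_mono bdd upper_finite_const upper_finite_bounded[OF bdd] bounded_rv_const
          simp: abs_le_iff minus_le_iff)
    then show ?thesis by (simp add: upper_const abs_le_iff)
  qed
  have 2: "h' x \<le> h' y + L * \<bar>x - y\<bar>" for x y
    unfolding h'_def
  proof (intro upper_diff_le bdd)
    show "h (x + X (Suc n) \<omega>) \<le> h (y + X (Suc n) \<omega>) + L * \<bar>x - y\<bar>" for \<omega>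
      using step.prems(2)[of "x + X (Suc n) \<omega>" "y + X (Suc n) \<omega>"] by (simp add: abs_le_iff)
  qed
  have 3: "\<bar>h' x - h' y\<bar> \<le> L * \<bar>x - y\<bar>" for x y
    using 2[of x y] 2[of y x] by (auto simp: abs_le_iff abs_minus_commute)
  obtain u where u: "\<forall>x. \<bar>u x\<bar> \<le> B" "\<forall>x y. \<bar>u x - u y\<bar> \<le> L * \<bar>x - y\<bar>"
    "\<And>G. bl_lip {1..m} G \<and> (\<forall>x. 0 \<le> G x) \<Longrightarrow>
      E (\<lambda>\<omega>. G (\<lambda>i. X i \<omega>) * h' (\<Sum>i=1..n. X i \<omega>)) =
      E (\<lambda>\<omega>. G (\<lambda>i. X i \<omega>) * u (\<Sum>i=1..m. X i \<omega>))"
    using step.IH[OF 1 3] by blast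
  have "E (\<lambda>\<omega>. G (\<lambda>i. X i \<omega>) * h (\<Sum>i=1..Suc n. X i \<omega>)) =
      E (\<lambda>\<omega>. G (\<lambda>i. X i \<omega>) * h' (\<Sum>i=1..n. X i \<omega>))"
    if G: "bl_lip {1..m} G" "\<And>x. 0 \<le> G x" for G
  proof -
    have G': "bl_lip {1..Suc n} G"
      using step.hyps by (intro bl_lip_mono[OF G(1)]) auto
    define \<phi> where "\<phi> = (\<lambda>x. G x * h (\<Sum>i=1..Suc n. x i))"
    have "bl_lip {1..Suc n} \<phi>"
      unfolding \<phi>_def by (intro bl_lip_mult G' bl_lip_comp_sum cbl) auto
    then have "E (\<lambda>\<omega>. \<phi> (\<lambda>i. X i \<omega>)) =
       E (\<lambda>\<omega>. E (\<lambda>\<omega>'. \<phi> (\<lambda>i. if i = Suc n then X (Suc n) \<omega>' else X i \<omega>)))"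
      using ind unfolding indep_seq_def by blast
    \<comment> \<open>The replaced coordinate \<open>Suc n\<close> lies outside
      \<open>{1..m}\<close>, so \<open>G\<close> does not see it and only the sum changes.\<close>
    also have "(\<lambda>\<omega> \<omega>'. \<phi> (\<lambda>i. if i = Suc n then X (Suc n) \<omega>' else X i \<omega>)) =
       (\<lambda>\<omega> \<omega>'. G (\<lambda>i. X i \<omega>) * h ((\<Sum>i=1..n. X i \<omega>) + X (Suc n) \<omega>'))"
    proof (intro ext)
      fix \<omega> \<omega>'
      have "G (\<lambda>i. if i = Suc n then X (Suc n) \<omega>' else X i \<omega>) = G (\<lambda>i. X i \<omega>)"
        using step.hyps by (intro bl_lip_cong[OF G(1)]) auto
      then show "\<phi> (\<lambda>i. if i = Suc n then X (Suc n) \<omega>' else X i \<omega>) =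
         G (\<lambda>i. X i \<omega>) * h ((\<Sum>i=1..n. X i \<omega>) + X (Suc n) \<omega>')"
        unfolding \<phi>_def by simp
    qed
    finally show ?thesis
      unfolding \<phi>_def h'_def
      by (subst (asm) upper_cmult) (auto simp: upper_finite_bounded[OF bdd] G(2))
  qed
  with u show ?case
    by (intro exI[of _ u]) auto
qed

end

section \<open>Consequences of the Berry-Esseen bound\<close>

locale song_clt =
  sublinear_expectation M H Ps + lim: sublinear_expectation M' H' Ps'
  for M :: "'a measure" and H Ps and M' :: "'b measure" and H' Ps' +
  fixes X :: "nat \<Rightarrow> 'a \<Rightarrow> real" and \<xi> :: "'b \<Rightarrow> real" and \<beta> \<alpha> :: real
  assumes \<beta>: "\<beta> \<ge> 1" and adm: "admissible H Ps \<beta> X" and \<xi>_in: "\<xi> \<in> H'"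
    and \<xi>_square: "upper_finite Ps' (\<lambda>\<omega>. (\<xi> \<omega>)\<^sup>2)"
    and \<alpha>: "0 < \<alpha>" "\<alpha> < 1" and song: "song_bound H Ps Ps' \<xi> \<beta> \<alpha>"
    and moment: "moment_bdd Ps X (2 + \<alpha>)"
begin

abbreviation "B \<equiv> Bn Ps X"
abbreviation "W \<equiv> Wn Ps X"

lemma X_in_H: "i \<ge> 1 \<Longrightarrow> X i \<in> H"
  and indep: "indep_seq Ps X"
  using adm unfolding admissible_def by auto

lemma W_measurable [measurable]: "W n \<in> borel_measurable M"
proof -
  have "(\<lambda>\<omega>. (\<Sum>i=1..n. X i \<omega>) / B n) \<in> borel_measurable M"
    using H_measurable[OF X_in_H] by (intro borel_measurable_divide borel_measurable_sum) auto
  then show ?thesis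
    unfolding Wn_def[abs_def] .
qed

lemma \<xi>_measurable: "\<xi> \<in> borel_measurable M'"
  by (rule lim.H_measurable[OF \<xi>_in])

lemma sig_bounds:
  obtains c K where "0 < c" "\<And>i. i \<ge> 1 \<Longrightarrow> c \<le> sig Ps X i" "\<And>i. i \<ge> 1 \<Longrightarrow> sig Ps X i \<le> K"
proof -
  obtain c K where c: "c > 0" "\<And>i. i \<ge> 1 \<Longrightarrow> c \<le> (sig_low Ps X i)\<^sup>2"
    and K: "\<And>i. i \<ge> 1 \<Longrightarrow> (sig_up Ps X i)\<^sup>2 \<le> K"
    using adm unfolding admissible_def by blast
  have bounds: "sqrt c \<le> sig_low Ps X i \<and> sig_low Ps X i \<le> sig_up Ps X i \<and> sig_up Ps X i \<le> sqrt K"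
    if i: "i \<ge> 1" for i
  proof -
    have "upper_finite Ps (\<lambda>\<omega>. (X i \<omega>)\<^sup>2)"
      using adm i unfolding admissible_def by auto
    then have up: "sig_up Ps X i \<ge> 0"
      unfolding sig_up_def by (auto intro: upper_nonneg)
    have nz: "sig_low Ps X i \<noteq> 0"
      using c(2)[OF i] c(1) by auto
    have "sig_up Ps X i / sig_low Ps X i = \<beta>"
      using adm i unfolding admissible_def by auto
    with nz have eq: "sig_up Ps X i = \<beta> * sig_low Ps X i"
      by (simp add: field_simps)
    \<comment> \<open>The real square root of a negative number is negative here, so the sign of
      \<open>sig_low\<close> is not automatic: it follows from \<open>sig_up \<ge> 0\<close>, the
      positive ratio \<open>\<beta>\<close> and nonvanishing.\<close>
    with up \<beta> nz have low: "sig_low Ps X i > 0"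
      by (auto simp: zero_le_mult_iff less_le)
    then have "sig_low Ps X i \<le> sig_up Ps X i"
      using \<beta> eq by simp
    then show ?thesis
      using low up c(2)[OF i] K[OF i] by (auto intro: real_le_lsqrt real_le_rsqrt)
  qed
  show thesis
  proof (rule that[of "sqrt c" "sqrt K"])
    show "sqrt c \<le> sig Ps X i" "sig Ps X i \<le> sqrt K" if "i \<ge> 1" for i
      using bounds[OF that] unfolding sig_def by (auto simp: field_simps)
  qed (use c in auto)
qed

text \<open>Summing the uniform bounds on \<open>sig\<close> makes ratios of normalizers comparable
  to powers of ratios of indices.\<close>

lemma B_bounds:
  obtains c K where "0 < c" "0 < K" "\<And>n. c * sqrt n \<le> B n" "\<And>n. B n \<le> K * sqrt n"
proof -
  obtain c K where c: "0 < c" "\<And>i. i \<ge> 1 \<Longrightarrow> c \<le> sig Ps X i" "\<And>i. i \<ge> 1 \<Longrightarrow> sig Ps X i \<le> K"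
    using sig_bounds by blast
  have K: "K > 0"
    using c(1) c(2,3)[of 1] by auto
  have "(\<Sum>i=1..n. (sig Ps X i)\<^sup>2) \<ge> of_nat (card {1..n}) * c\<^sup>2" for n
    using c by (intro sum_bounded_below power_mono) auto
  then have 1: "(\<Sum>i=1..n. (sig Ps X i)\<^sup>2) \<ge> c\<^sup>2 * n" for n
    by (simp add: mult.commute)
  have "(sig Ps X i)\<^sup>2 \<le> K\<^sup>2" if "i \<ge> 1" for i
    using c(1) c(2,3)[OF that] by (intro power_mono) auto
  then have "(\<Sum>i=1..n. (sig Ps X i)\<^sup>2) \<le> of_nat (card {1..n}) * K\<^sup>2" for n
    by (intro sum_bounded_above) auto
  then have 2: "(\<Sum>i=1..n. (sig Ps X i)\<^sup>2) \<le> K\<^sup>2 * n" for n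
    by (simp add: mult.commute)
  show thesis
  proof (rule that[OF c(1) K])
    show "c * sqrt n \<le> B n" for n
      using real_sqrt_le_mono[OF 1[of n]] c(1) unfolding Bn_def by (simp add: real_sqrt_mult)
    show "B n \<le> K * sqrt n" for n
      using real_sqrt_le_mono[OF 2[of n]] K unfolding Bn_def by (simp add: real_sqrt_mult)
  qed
qed

lemma B_pos:
  assumes "n \<ge> 1"
  shows "B n > 0"
proof -
  obtain c where "c > 0" "c * sqrt n \<le> B n"
    using B_bounds by metis
  moreover have "c * sqrt n > 0"
    using \<open>c > 0\<close> assms by simp
  ultimately show ?thesis by linarith
qed

text \<open>Bounded moments of order \<open>2 + \<alpha>\<close>, \<open>sig\<close> bounded away
  from zero and \<open>B n\<close> of order \<open>sqrt n\<close> make every term of Song's maximum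
  at most a constant times n to the power \<open>- (\<alpha> / 2)\<close>. Dividing by
  \<open>L\<close> reduces to 1-Lipschitz functions, and positive homogeneity of both upper
  expectations undoes the division.\<close>

lemma berry_esseen:
  obtains C where "C \<ge> 0" "\<And>n f L. \<lbrakk>n \<ge> 1; cbl f; L > 0; \<And>x y. \<bar>f x - f y\<bar> \<le> L * \<bar>x - y\<bar>\<rbrakk> \<Longrightarrow>
      \<bar>E (\<lambda>\<omega>. f (W n \<omega>)) - lim.E (\<lambda>\<omega>. f (\<xi> \<omega>))\<bar> \<le> C * L * real n powr (- (\<alpha> / 2))"
proof -
  obtain C where C: "C > 0" "\<And>n f. \<lbrakk>n \<ge> 1; cbl f; lip1 f\<rbrakk> \<Longrightarrow>
      \<bar>E (\<lambda>\<omega>. f (W n \<omega>)) - lim.E (\<lambda>\<omega>. f (\<xi> \<omega>))\<bar>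
        \<le> C * (MAX i\<in>{1..n}. E (\<lambda>\<omega>. \<bar>X i \<omega>\<bar> powr (2 + \<alpha>)) / sig Ps X i powr (2 + \<alpha>)
                 * (sig Ps X i / B n) powr \<alpha>)"
    using song adm moment unfolding song_bound_def by blast
  obtain s S where s: "0 < s" "\<And>i. i \<ge> 1 \<Longrightarrow> s \<le> sig Ps X i" "\<And>i. i \<ge> 1 \<Longrightarrow> sig Ps X i \<le> S"
    using sig_bounds by blast
  have S: "S > 0"
    using s(1) s(2,3)[of 1] by auto
  obtain b where b: "0 < b" "\<And>n. b * sqrt n \<le> B n"
    using B_bounds by metis
  obtain K where K: "\<And>i. i \<ge> 1 \<Longrightarrow> E (\<lambda>\<omega>. \<bar>X i \<omega>\<bar> powr (2 + \<alpha>)) \<le> K"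
    using moment unfolding moment_bdd_def by blast
  have K0: "E (\<lambda>\<omega>. \<bar>X i \<omega>\<bar> powr (2 + \<alpha>)) \<ge> 0" if "i \<ge> 1" for i
    using moment that unfolding moment_bdd_def by (intro upper_nonneg) auto
  have Kpos: "K \<ge> 0"
    using K0[of 1] K[of 1] by simp
  define D where "D = K / s powr (2 + \<alpha>) * (S / b) powr \<alpha>"
  have D: "D \<ge> 0"
    using Kpos unfolding D_def by simp
  have max: "(MAX i\<in>{1..n}. E (\<lambda>\<omega>. \<bar>X i \<omega>\<bar> powr (2 + \<alpha>)) / sig Ps X i powr (2 + \<alpha>)
                 * (sig Ps X i / B n) powr \<alpha>) \<le> D * real n powr (- (\<alpha> / 2))" if n: "n \<ge> 1" for n
  proof (subst Max_le_iff; (intro ballI)?)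
    fix y assume "y \<in> (\<lambda>i. E (\<lambda>\<omega>. \<bar>X i \<omega>\<bar> powr (2 + \<alpha>)) / sig Ps X i powr (2 + \<alpha>)
                 * (sig Ps X i / B n) powr \<alpha>) ` {1..n}"
    then obtain i where i: "i \<ge> 1" and y: "y = E (\<lambda>\<omega>. \<bar>X i \<omega>\<bar> powr (2 + \<alpha>)) / sig Ps X i powr (2 + \<alpha>)
                 * (sig Ps X i / B n) powr \<alpha>"
      by auto
    have "sig Ps X i / B n \<le> S / (b * sqrt n)"
      using s(1) s(2,3)[OF i] b n by (intro frac_le) auto
    then have "(sig Ps X i / B n) powr \<alpha> \<le> (S / (b * sqrt n)) powr \<alpha>"
      using s(1) s(2)[OF i] B_pos[OF n] \<alpha> by (intro powr_mono2) auto
    also have "(S / (b * sqrt n)) = (S / b) * real n powr (- (1 / 2))"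
      using n by (simp add: powr_minus powr_half_sqrt field_simps)
    also have "\<dots> powr \<alpha> = (S / b) powr \<alpha> * real n powr (- (\<alpha> / 2))"
      using S b by (subst powr_mult) (auto simp: powr_powr)
    finally have 1: "(sig Ps X i / B n) powr \<alpha> \<le> (S / b) powr \<alpha> * real n powr (- (\<alpha> / 2))" .
    have "E (\<lambda>\<omega>. \<bar>X i \<omega>\<bar> powr (2 + \<alpha>)) / sig Ps X i powr (2 + \<alpha>) \<le> K / s powr (2 + \<alpha>)"
      using K[OF i] K0[OF i] s(1) s(2)[OF i] \<alpha> by (intro frac_le powr_mono2) auto
    with 1 have "y \<le> (K / s powr (2 + \<alpha>)) * ((S / b) powr \<alpha> * real n powr (- (\<alpha> / 2)))"
      unfolding y using Kpos by (intro mult_mono) auto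
    then show "y \<le> D * real n powr (- (\<alpha> / 2))"
      unfolding D_def by (simp add: mult.assoc)
  qed (use n in auto)
  show thesis
  proof (rule that[of "C * D"])
    fix n f L assume n: "n \<ge> (1::nat)" and f: "cbl f" and L: "L > (0::real)"
      and lip: "\<And>x y. \<bar>f x - f y\<bar> \<le> L * \<bar>x - y\<bar>"
    define g where "g = (\<lambda>x. f x / L)"
    have f_eq: "f x = L * g x" for x
      using L unfolding g_def by simp
    have lip1: "lip1 g"
      unfolding lip1_def g_def using lip L
      by (auto simp: diff_divide_distrib[symmetric] field_simps)
    obtain b where "\<And>x. \<bar>f x\<bar> \<le> b"
      using f unfolding cbl_def by blast
    then have g: "cbl g"
      using lip1 L unfolding lip1_def g_def
      by (intro cblI[of _ "b / L" 1]) (auto simp: divide_right_mono)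
    have "\<bar>E (\<lambda>\<omega>. g (W n \<omega>)) - lim.E (\<lambda>\<omega>. g (\<xi> \<omega>))\<bar> \<le> C * (D * real n powr (- (\<alpha> / 2)))"
      using C(2)[OF n g lip1] mult_left_mono[OF max[OF n], of C] C(1) by linarith
    then have "L * \<bar>E (\<lambda>\<omega>. g (W n \<omega>)) - lim.E (\<lambda>\<omega>. g (\<xi> \<omega>))\<bar>
        \<le> L * (C * (D * real n powr (- (\<alpha> / 2))))"
      using L by (intro mult_left_mono) auto
    moreover have "E (\<lambda>\<omega>. f (W n \<omega>)) = L * E (\<lambda>\<omega>. g (W n \<omega>))"
      unfolding f_eq using L
      by (intro upper_cmult upper_finite_bounded bounded_rv_cbl g) auto
    moreover have "lim.E (\<lambda>\<omega>. f (\<xi> \<omega>)) = L * lim.E (\<lambda>\<omega>. g (\<xi> \<omega>))"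
      unfolding f_eq using L \<xi>_measurable
      by (intro lim.upper_cmult lim.upper_finite_bounded lim.bounded_rv_cbl g) auto
    ultimately show "\<bar>E (\<lambda>\<omega>. f (W n \<omega>)) - lim.E (\<lambda>\<omega>. f (\<xi> \<omega>))\<bar> \<le> C * D * L * real n powr (- (\<alpha> / 2))"
      using L by (simp add: right_diff_distrib[symmetric] abs_mult mult_ac)
  qed (use C D in auto)
qed

text \<open>The bound is uniform in \<open>N\<close> because the truncated modulus is 1-Lipschitz at
  every level, and at \<open>\<xi>\<close> it is dominated by the square plus one. The truncation
  keeps the test function bounded.\<close>

lemma truncated_first_moment:
  obtains C where "C \<ge> 0" "\<And>n N. n \<ge> 1 \<Longrightarrow> E (\<lambda>\<omega>. min \<bar>W n \<omega>\<bar> N) \<le> C"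
proof -
  obtain C where C: "C \<ge> 0" "\<And>n f L. \<lbrakk>n \<ge> 1; cbl f; L > 0; \<And>x y. \<bar>f x - f y\<bar> \<le> L * \<bar>x - y\<bar>\<rbrakk> \<Longrightarrow>
      \<bar>E (\<lambda>\<omega>. f (W n \<omega>)) - lim.E (\<lambda>\<omega>. f (\<xi> \<omega>))\<bar> \<le> C * L * real n powr (- (\<alpha> / 2))"
    using berry_esseen by blast
  have fin: "upper_finite Ps' (\<lambda>\<omega>. (\<xi> \<omega>)\<^sup>2 + 1)"
    by (intro lim.upper_finite_add lim.upper_finite_const \<xi>_square)
  show thesis
  proof (rule that[of "C + lim.E (\<lambda>\<omega>. (\<xi> \<omega>)\<^sup>2 + 1)"])
    show "C + lim.E (\<lambda>\<omega>. (\<xi> \<omega>)\<^sup>2 + 1) \<ge> 0"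
      using C(1) lim.upper_nonneg[OF fin] by simp
    fix n :: nat and N :: real
    assume n: "n \<ge> 1"
    have "\<bar>E (\<lambda>\<omega>. min \<bar>W n \<omega>\<bar> N) - lim.E (\<lambda>\<omega>. min \<bar>\<xi> \<omega>\<bar> N)\<bar> \<le> C * 1 * real n powr (- (\<alpha> / 2))"
      by (rule C(2)[OF n cbl_min_abs]) (auto simp: min_def)
    also have "real n powr (- (\<alpha> / 2)) \<le> 1"
      using n \<alpha> powr_mono[of "- (\<alpha> / 2)" 0 "real n"] by simp
    then have "C * 1 * real n powr (- (\<alpha> / 2)) \<le> C"
      using C(1) mult_left_mono by fastforce
    finally have "E (\<lambda>\<omega>. min \<bar>W n \<omega>\<bar> N) \<le> C + lim.E (\<lambda>\<omega>. min \<bar>\<xi> \<omega>\<bar> N)"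
      by linarith
    also have "lim.E (\<lambda>\<omega>. min \<bar>\<xi> \<omega>\<bar> N) \<le> lim.E (\<lambda>\<omega>. (\<xi> \<omega>)\<^sup>2 + 1)"
    proof (rule lim.upper_mono[OF lim.bounded_rv_cbl[OF cbl_min_abs \<xi>_measurable] fin])
      fix \<omega>
      have "0 \<le> (\<bar>\<xi> \<omega>\<bar> - 1)\<^sup>2"
        by simp
      then have "2 * \<bar>\<xi> \<omega>\<bar> \<le> (\<xi> \<omega>)\<^sup>2 + 1"
        by (simp add: power2_diff)
      then show "min \<bar>\<xi> \<omega>\<bar> N \<le> (\<xi> \<omega>)\<^sup>2 + 1"
        by linarith
    qed
    finally show "E (\<lambda>\<omega>. min \<bar>W n \<omega>\<bar> N) \<le> C + lim.E (\<lambda>\<omega>. (\<xi> \<omega>)\<^sup>2 + 1)"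
      by simp
  qed
qed

text \<open>Replacing \<open>S\<^sub>n\<close> by the increment \<open>S\<^sub>n - S\<^sub>m\<close> costs \<open>B\<^sub>m / B\<^sub>n\<close>; the increment is
  independent of the weight \<open>G\<close>, and its upper expectation is nonpositive up to the rate
  in the Berry-Esseen bound.\<close>
lemma weighted_upper_bound:
  obtains C where "C \<ge> 0"
    "\<And>m n g L b G T. \<lbrakk>1 \<le> m; m \<le> n; L > 0; b > 0; \<And>x. \<bar>g x\<bar> \<le> b; \<And>x y. \<bar>g x - g y\<bar> \<le> L * \<bar>x - y\<bar>;
       lim.E (\<lambda>\<omega>. g (\<xi> \<omega>)) \<le> 0; bl_lip {1..m} G; \<And>x. 0 \<le> G x; \<And>x. G x \<le> T\<rbrakk> \<Longrightarrow>
      E (\<lambda>\<omega>. G (\<lambda>i. X i \<omega>) * g (W n \<omega>)) \<le> C * L * T * (real m / real n) powr (\<alpha> / 2)"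
proof -
  obtain C1 where C1: "C1 \<ge> 0" "\<And>n f L. \<lbrakk>n \<ge> 1; cbl f; L > 0; \<And>x y. \<bar>f x - f y\<bar> \<le> L * \<bar>x - y\<bar>\<rbrakk> \<Longrightarrow>
      \<bar>E (\<lambda>\<omega>. f (W n \<omega>)) - lim.E (\<lambda>\<omega>. f (\<xi> \<omega>))\<bar> \<le> C1 * L * real n powr (- (\<alpha> / 2))"
    using berry_esseen by blast
  obtain C2 where C2: "C2 \<ge> 0" "\<And>n N. n \<ge> 1 \<Longrightarrow> E (\<lambda>\<omega>. min \<bar>W n \<omega>\<bar> N) \<le> C2"
    using truncated_first_moment by blast
  obtain c K where cK: "0 < c" "0 < K" "\<And>n. c * sqrt n \<le> B n" "\<And>n. B n \<le> K * sqrt n"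
    using B_bounds by blast
  show thesis
  \<comment> \<open>The factor 2 arises because the distance from \<open>u (S m \<omega>)\<close> to
    \<open>u 0\<close> is paid twice: once in bounding \<open>u 0\<close>, once in the weighted
    expectation.\<close>
  proof (rule that[of "C1 + 2 * (K / c * C2)"])
    show "C1 + 2 * (K / c * C2) \<ge> 0"
      using C1(1) C2(1) cK by simp
    fix m n :: nat and g :: "real \<Rightarrow> real" and L b :: real and G :: "(nat \<Rightarrow> real) \<Rightarrow> real" and T :: real
    assume m: "1 \<le> m" "m \<le> n" and L: "L > 0" and b: "b > 0" and gb: "\<And>x. \<bar>g x\<bar> \<le> b"
      and gL: "\<And>x y. \<bar>g x - g y\<bar> \<le> L * \<bar>x - y\<bar>"
      and g0: "lim.E (\<lambda>\<omega>. g (\<xi> \<omega>)) \<le> 0"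
      and G: "bl_lip {1..m} G" "\<And>x. 0 \<le> G x" "\<And>x. G x \<le> T"
    have n: "n \<ge> 1"
      using m by simp
    have T: "T \<ge> 0"
      using G(2,3)[of "\<lambda>_. 0"] by simp
    have Bp: "B m > 0" "B n > 0"
      using B_pos m n by auto
    have cbl_g: "cbl g"
      using gb gL by (rule cblI)
    define S where "S = (\<lambda>k \<omega>. \<Sum>i=1..k. X i \<omega>)"
    have W_eq: "W k \<omega> = S k \<omega> / B k" for k \<omega>
      unfolding Wn_def S_def ..
    define h where "h = (\<lambda>s. g (s / B n))"
    have hb: "\<bar>h x\<bar> \<le> b" for x
      unfolding h_def by (rule gb)
    have hL: "\<bar>h x - h y\<bar> \<le> L / B n * \<bar>x - y\<bar>" for x y
      using gL[of "x / B n" "y / B n"] Bp unfolding h_def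
      by (simp add: diff_divide_distrib[symmetric])
    obtain u where ub: "\<And>x. \<bar>u x\<bar> \<le> b" and uL: "\<And>x y. \<bar>u x - u y\<bar> \<le> L / B n * \<bar>x - y\<bar>"
      and u: "\<And>G. bl_lip {1..m} G \<Longrightarrow> (\<And>x. 0 \<le> G x) \<Longrightarrow>
        E (\<lambda>\<omega>. G (\<lambda>i. X i \<omega>) * h (S n \<omega>)) = E (\<lambda>\<omega>. G (\<lambda>i. X i \<omega>) * u (S m \<omega>))"
      using integrate_out_increments[OF X_in_H indep m(2) hb hL] unfolding S_def by blast
    have cbl_u: "cbl u"
      using ub uL by (rule cblI)
    have S_meas: "S k \<in> borel_measurable M" for k
      unfolding S_def using H_measurable[OF X_in_H] by (intro borel_measurable_sum) auto
    have bu: "bounded_rv (\<lambda>\<omega>. u (S m \<omega>))"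
      by (intro bounded_rv_cbl cbl_u S_meas)
    \<comment> \<open>The truncation level satisfies \<open>r * N = 2 * b\<close>, the trivial bound
      on the oscillation of \<open>u\<close>. Hence \<open>D\<close> dominates that oscillation
      whether or not the minimum truncates.\<close>
    define N where "N = 2 * b * B n / (L * B m)"
    define r where "r = L * B m / B n"
    have r: "r \<ge> 0"
      unfolding r_def using L Bp by simp
    define D where "D = (\<lambda>\<omega>. r * min \<bar>W m \<omega>\<bar> N)"
    have bW: "bounded_rv (\<lambda>\<omega>. min \<bar>W m \<omega>\<bar> N)"
      by (intro bounded_rv_cbl cbl_min_abs W_measurable)
    have bD: "bounded_rv D"
      unfolding D_def by (intro bounded_rv_mult bounded_rv_const bW)
    have ED: "E D \<le> r * C2"
      unfolding D_def using r C2(2)[OF m(1), of N]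
      by (subst upper_cmult) (auto intro: mult_left_mono upper_finite_bounded bW)
    have diff: "\<bar>u (S m \<omega>) - u 0\<bar> \<le> D \<omega>" for \<omega>
    proof -
      have "\<bar>u (S m \<omega>) - u 0\<bar> \<le> r * \<bar>W m \<omega>\<bar>"
        using uL[of "S m \<omega>" 0] Bp unfolding r_def W_eq by (simp add: field_simps)
      moreover have "\<bar>u (S m \<omega>) - u 0\<bar> \<le> r * N"
        using ub[of "S m \<omega>"] ub[of 0] Bp L unfolding r_def N_def by (simp add: field_simps)
      ultimately show ?thesis
        unfolding D_def using r by (cases "\<bar>W m \<omega>\<bar> \<le> N") (auto simp: min_def)
    qed
    \<comment> \<open>The weight 1 identifies the mean of \<open>u (S m \<omega>)\<close> with that
      of \<open>g (W n \<omega>)\<close>, to which the Berry-Esseen bound applies.\<close>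
    have Eu: "E (\<lambda>\<omega>. u (S m \<omega>)) = E (\<lambda>\<omega>. g (W n \<omega>))"
      using u[of "\<lambda>_. 1"] unfolding h_def W_eq by (simp add: bl_lip_const)
    have "u 0 = E (\<lambda>\<omega>. u 0)"
      by (simp add: upper_const)
    also have "\<dots> \<le> E (\<lambda>\<omega>. u (S m \<omega>) + D \<omega>)"
    proof (intro upper_mono bounded_rv_const upper_finite_bounded bounded_rv_add bu bD)
      show "u 0 \<le> u (S m \<omega>) + D \<omega>" for \<omega>
        using diff[of \<omega>] by (simp add: abs_le_iff)
    qed
    also have "\<dots> \<le> E (\<lambda>\<omega>. u (S m \<omega>)) + E D"
      by (intro upper_add upper_finite_bounded bu bD)
    also have "\<dots> \<le> C1 * L * real n powr (- (\<alpha> / 2)) + r * C2"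
      using C1(2)[OF n cbl_g L gL] g0 ED unfolding Eu by (simp add: abs_le_iff)
    finally have u0: "u 0 \<le> C1 * L * real n powr (- (\<alpha> / 2)) + r * C2" .
    \<comment> \<open>A common majorant for both errors: the Berry-Esseen rate is below
      \<open>q\<close> since \<open>m \<ge> 1\<close>, and \<open>sqrt (m / n)\<close> is below
      \<open>q\<close> since \<open>m \<le> n\<close> and
      \<open>\<alpha> / 2 \<le> 1 / 2\<close>.\<close>
    define q where "q = (real m / real n) powr (\<alpha> / 2)"
    have "real n powr (- (\<alpha> / 2)) = (1 / real n) powr (\<alpha> / 2)"
      using n by (simp add: powr_minus powr_divide inverse_eq_divide)
    also have "\<dots> \<le> q"
      unfolding q_def using m n \<alpha> by (intro powr_mono2 divide_right_mono) auto
    finally have q1: "real n powr (- (\<alpha> / 2)) \<le> q" .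
    have "sqrt (real m / real n) = (real m / real n) powr (1 / 2)"
      using m by (simp add: powr_half_sqrt)
    also have "\<dots> \<le> q"
      unfolding q_def using \<alpha> m n by (intro powr_mono') auto
    finally have sq: "sqrt (real m / real n) \<le> q" .
    have "r \<le> L * (K * sqrt m) / (c * sqrt n)"
      unfolding r_def using L cK Bp n by (intro frac_le mult_left_mono) auto
    also have "\<dots> = L * (K / c) * sqrt (real m / real n)"
      by (simp add: real_sqrt_divide)
    also have "\<dots> \<le> L * (K / c) * q"
      using L cK by (intro mult_left_mono sq) auto
    finally have q2: "r \<le> L * (K / c) * q" .
    have q0: "q \<ge> 0"
      unfolding q_def by simp
    have "C1 * L * real n powr (- (\<alpha> / 2)) \<le> C1 * L * q"
      using q1 C1(1) L by (intro mult_left_mono) auto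
    moreover have "r * C2 \<le> L * (K / c) * q * C2"
      by (intro mult_right_mono q2 C2(1))
    ultimately have u0': "u 0 \<le> C1 * L * q + L * (K / c) * q * C2" and ED': "E D \<le> L * (K / c) * q * C2"
      using ED u0 by auto
    define e where "e = C1 * L * q + L * (K / c) * q * C2"
    have e: "e \<ge> 0"
      unfolding e_def using C1(1) C2(1) L cK q0 by simp
    have bG: "bounded_rv (\<lambda>\<omega>. G (\<lambda>i. X i \<omega>))"
      using X_in_H by (intro bounded_rv_bl_lip[OF _ _ G(1)]) auto
    have "E (\<lambda>\<omega>. G (\<lambda>i. X i \<omega>) * g (W n \<omega>)) = E (\<lambda>\<omega>. G (\<lambda>i. X i \<omega>) * u (S m \<omega>))"
      using u[OF G(1,2)] unfolding h_def W_eq by simp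
    also have "\<dots> \<le> E (\<lambda>\<omega>. T * D \<omega> + T * e)"
    proof (intro upper_mono upper_finite_bounded bounded_rv_add bounded_rv_mult bounded_rv_const bG bu bD)
      fix \<omega>
      \<comment> \<open>The first inequality may be multiplied by \<open>G \<ge> 0\<close>; the
        second then allows \<open>G\<close> to be enlarged to \<open>T\<close>.\<close>
      have "u (S m \<omega>) \<le> D \<omega> + e" "0 \<le> D \<omega> + e"
        using diff[of \<omega>] u0' e unfolding e_def by (auto simp: abs_le_iff intro: order_trans[OF abs_ge_zero])
      then have "G (\<lambda>i. X i \<omega>) * u (S m \<omega>) \<le> G (\<lambda>i. X i \<omega>) * (D \<omega> + e)"
        "G (\<lambda>i. X i \<omega>) * (D \<omega> + e) \<le> T * (D \<omega> + e)"
        using G(2,3) by (auto intro: mult_left_mono mult_right_mono)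
      then show "G (\<lambda>i. X i \<omega>) * u (S m \<omega>) \<le> T * D \<omega> + T * e"
        by (simp add: distrib_left)
    qed
    also have "\<dots> = T * E D + T * e"
      using T by (subst upper_add_const) (auto simp: upper_cmult upper_finite_bounded bD intro!: bounded_rv_mult bounded_rv_const)
    also have "\<dots> \<le> T * (L * (K / c) * q * C2) + T * e"
      by (intro add_right_mono mult_left_mono ED' T)
    also have "\<dots> = (C1 + 2 * (K / c * C2)) * L * T * q"
      unfolding e_def by (simp add: algebra_simps)
    finally show "E (\<lambda>\<omega>. G (\<lambda>i. X i \<omega>) * g (W n \<omega>)) \<le> (C1 + 2 * (K / c * C2)) * L * T * (real m / real n) powr (\<alpha> / 2)"
      unfolding q_def .
  qed
qed

end

section \<open>Logarithmic sums along a subsequence\<close>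

text \<open>The first summand is bounded by 1 and the others telescope through
  \<open>1 / (k + 1) \<le> ln (k + 1) - ln k\<close>. Starting the logarithm at \<open>Suc m\<close>
  covers \<open>m = 0\<close>.\<close>

lemma sum_inverse_le_ln:
  assumes "m < n"
  shows "(\<Sum>k\<in>{m<..n}. 1 / real k) \<le> 1 + ln (real n / real (Suc m))"
proof -
  have "Suc m \<le> n" using assms by simp
  then show ?thesis
  proof (induction n rule: dec_induct)
    case base
    have "{m<..Suc m} = {Suc m}" by auto
    then show ?case by simp
  next
    case (step n)
    have "ln (real n / real (Suc n)) \<le> real n / real (Suc n) - 1"
      using step.hyps by (intro ln_le_minus_one) auto
    also have "\<dots> = - (1 / real (Suc n))"
      by (simp add: field_simps)
    finally have "1 / real (Suc n) \<le> ln (real (Suc n)) - ln (real n)"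
      using step.hyps by (subst (asm) ln_div) auto
    moreover have "{m<..Suc n} = insert (Suc n) {m<..n}"
      using step.hyps by auto
    ultimately show ?case
      using step.IH step.hyps by (auto simp: ln_div)
  qed
qed

text \<open>The hypothesis is shaped for \<open>m = n div 2 ^ j\<close>, where rounding down only
  yields \<open>n < 2 ^ j * Suc m\<close>.\<close>

lemma sum_inverse_le_dyadic:
  assumes "n \<le> 2 ^ j * Suc m"
  shows "(\<Sum>k\<in>{m<..n}. 1 / real k) \<le> 1 + real j"
proof (cases "m < n")
  case True
  have "real n \<le> real (2 ^ j * Suc m)"
    using assms by (simp only: of_nat_le_iff)
  then have "real n / real (Suc m) \<le> 2 ^ j"
    by (simp add: divide_le_eq del: of_nat_Suc mult_Suc_right)
  then have "ln (real n / real (Suc m)) \<le> ln (2 ^ j)"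
    using True by (subst ln_le_cancel_iff) auto
  also have "\<dots> = real j * ln 2"
    by (simp add: ln_realpow)
  also have "\<dots> \<le> real j"
    using ln_le_minus_one[of 2] by (intro mult_left_le) auto
  finally show ?thesis
    using sum_inverse_le_ln[OF True] by linarith
qed simp

lemma harm_div_ln: "(\<lambda>n. harm n / ln (real n)) \<longlonglongrightarrow> 1"
proof -
  have "(\<lambda>n. (harm n - ln (real n)) * (1 / ln (real n))) \<longlonglongrightarrow> euler_mascheroni * 0"
  proof (rule tendsto_mult[OF euler_mascheroni_LIMSEQ])
    show "(\<lambda>n. 1 / ln (real n)) \<longlonglongrightarrow> 0" by real_asymp
  qed
  from tendsto_add[OF this tendsto_const[of 1]]
  have "(\<lambda>n. (harm n - ln (real n)) * (1 / ln (real n)) + 1) \<longlonglongrightarrow> 1"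
    by simp
  moreover have "eventually (\<lambda>n. (harm n - ln (real n)) * (1 / ln (real n)) + 1 = harm n / ln (real n)) sequentially"
    using eventually_gt_at_top[of 1] by eventually_elim (simp add: field_simps)
  ultimately show ?thesis
    by (rule Lim_transform_eventually)
qed

text \<open>The block is found as the least \<open>j\<close> whose right end exceeds
  \<open>n\<close>. The bound \<open>J \<le> j\<close> is what lets eventual estimates at the nodes
  reach all large \<open>n\<close>.\<close>

lemma cubic_dyadic_interval:
  assumes "2 ^ (J ^ 3) \<le> (n :: nat)"
  obtains j where "J \<le> j" "2 ^ (j ^ 3) \<le> n" "n \<le> 2 ^ ((Suc j) ^ 3)"
proof -
  define j where "j = (LEAST j. n < 2 ^ ((Suc j) ^ 3))"
  have "n < 2 ^ n" by (rule less_exp)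
  also have "n \<le> Suc n ^ 3"
    using self_le_power[of "Suc n" 3] by linarith
  then have "(2::nat) ^ n \<le> 2 ^ (Suc n ^ 3)"
    by (intro power_increasing) auto
  finally have up: "n < 2 ^ ((Suc j) ^ 3)"
    unfolding j_def by (rule LeastI)
  have low: "2 ^ (j ^ 3) \<le> n"
  proof (cases j)
    case 0
    have "(1::nat) \<le> 2 ^ (J ^ 3)" by simp
    then have "1 \<le> n" using assms by linarith
    then show ?thesis using 0 by simp
  next
    case (Suc i)
    have "\<not> n < 2 ^ ((Suc i) ^ 3)"
      using not_less_Least[of i "\<lambda>j. n < 2 ^ ((Suc j) ^ 3)"] Suc unfolding j_def by auto
    then show ?thesis using Suc by simp
  qed
  have "J \<le> j"
  proof (rule ccontr)
    assume "\<not> J \<le> j"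
    then have "(2::nat) ^ ((Suc j) ^ 3) \<le> 2 ^ (J ^ 3)"
      by (intro power_increasing power_mono) auto
    then show False using assms up by linarith
  qed
  then show thesis using that low up by auto
qed

text \<open>Consecutive nodes differ by the factor 2 to the power
  \<open>3 * j ^ 2 + 3 * j + 1\<close>, so \<open>r\<close> moves by order \<open>j ^ 2\<close>
  between them. This is negligible against \<open>ln n\<close>, which is at least of order
  \<open>j ^ 3\<close>.\<close>

lemma interpolate_log_growth:
  fixes r :: "nat \<Rightarrow> real"
  assumes incr: "\<And>m n. m \<le> n \<Longrightarrow> \<bar>r n - r m\<bar> \<le> b * (\<Sum>k\<in>{m<..n}. 1 / real k)" and b: "b > 0" and \<epsilon>: "\<epsilon> > 0"
    and sub: "eventually (\<lambda>j. r (2 ^ (j ^ 3)) \<le> \<epsilon> / 4 * real j ^ 3) sequentially"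
  shows "eventually (\<lambda>n. r n \<le> \<epsilon> * ln (real n)) sequentially"
proof -
  have "eventually (\<lambda>j. b * (2 + 3 * real j + 3 * real j ^ 2) \<le> \<epsilon> / 4 * real j ^ 3) sequentially"
    using b \<epsilon> by real_asymp
  with sub obtain J where J: "\<And>j. j \<ge> J \<Longrightarrow> r (2 ^ (j ^ 3)) \<le> \<epsilon> / 4 * real j ^ 3"
    "\<And>j. j \<ge> J \<Longrightarrow> b * (2 + 3 * real j + 3 * real j ^ 2) \<le> \<epsilon> / 4 * real j ^ 3"
    unfolding eventually_sequentially by (meson le_trans linear)
  show ?thesis
    unfolding eventually_sequentially
  proof (intro exI[of _ "2 ^ (J ^ 3)"] allI impI)
    fix n :: nat assume "2 ^ (J ^ 3) \<le> n"
    then obtain j where j: "J \<le> j" "2 ^ (j ^ 3) \<le> n" "n \<le> 2 ^ ((Suc j) ^ 3)"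
      by (rule cubic_dyadic_interval)
    define d where "d = (Suc j) ^ 3 - j ^ 3"
    have d: "(Suc j) ^ 3 = d + j ^ 3"
      unfolding d_def using power_mono[of j "Suc j" 3] by simp
    have "(Suc j) ^ 3 = (3 * j ^ 2 + 3 * j + 1) + j ^ 3"
      by (simp add: power3_eq_cube power2_eq_square distrib_left distrib_right)
    then have "d = 3 * j ^ 2 + 3 * j + 1"
      using d by linarith
    then have d_eq: "1 + real d = 2 + 3 * real j + 3 * real j ^ 2"
      by simp
    have "n \<le> 2 ^ d * 2 ^ (j ^ 3)"
      using j(3) unfolding d power_add .
    then have "(\<Sum>k\<in>{2 ^ (j ^ 3)<..n}. 1 / real k) \<le> 1 + real d"
      by (intro sum_inverse_le_dyadic) simp
    then have "b * (\<Sum>k\<in>{2 ^ (j ^ 3)<..n}. 1 / real k) \<le> b * (1 + real d)"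
      using b by (intro mult_left_mono) auto
    then have "r n \<le> r (2 ^ (j ^ 3)) + b * (1 + real d)"
      using incr[OF j(2)] by linarith
    also have "\<dots> \<le> \<epsilon> * (real j ^ 3 / 2)"
      using J[OF j(1)] unfolding d_eq by simp
    finally have r_le: "r n \<le> \<epsilon> * (real j ^ 3 / 2)" .
    have n_ge: "(2::real) ^ (j ^ 3) \<le> real n"
      using j(2) by (metis of_nat_le_iff of_nat_numeral of_nat_power)
    have n_pos: "0 < real n"
      by (rule less_le_trans[OF _ n_ge]) simp
    \<comment> \<open>Since \<open>ln 2 \<ge> 1 / 2\<close>, the node value and the increment may
      each take a quarter of \<open>\<epsilon> * real j ^ 3\<close>.\<close>
    have "real j ^ 3 / 2 \<le> real (j ^ 3) * ln 2"
      using ln2_ge_two_thirds mult_left_mono[of "1 / 2" "ln 2" "real j ^ 3"] by simp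
    also have "\<dots> = ln (2 ^ (j ^ 3))"
      by (simp add: ln_realpow)
    also have "\<dots> \<le> ln (real n)"
      using n_ge n_pos by (subst ln_le_cancel_iff) auto
    finally have "\<epsilon> * (real j ^ 3 / 2) \<le> \<epsilon> * ln (real n)"
      using \<epsilon> by (intro mult_left_mono) auto
    with r_le show "r n \<le> \<epsilon> * ln (real n)"
      by linarith
  qed
qed

section \<open>Almost sure upper bounds for the logarithmic averages of one test function\<close>

context song_clt
begin

definition log_sum :: "(real \<Rightarrow> real) \<Rightarrow> nat \<Rightarrow> 'a \<Rightarrow> real" where
  "log_sum g n \<omega> = (\<Sum>k=1..n. g (W k \<omega>) / real k)"

text \<open>Exhibits the sum as a function of the coordinates, so that its positive part can serve
  as the weight \<open>G\<close>. The bound holds at every \<open>x\<close>, not only at values of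
  \<open>X\<close>, because \<open>G x \<le> T\<close> is demanded everywhere.\<close>

lemma log_sum_bl_lip:
  assumes "cbl g"
  obtains \<phi> where "bl_lip {1..n} \<phi>" "\<And>\<omega>. log_sum g n \<omega> = \<phi> (\<lambda>i. X i \<omega>)"
    "\<And>b x. (\<And>y. \<bar>g y\<bar> \<le> b) \<Longrightarrow> \<bar>\<phi> x\<bar> \<le> b * harm n"
proof -
  define \<phi> where "\<phi> = (\<lambda>x. \<Sum>k=1..n. g ((\<Sum>i=1..k. x i) / B k) * (1 / real k))"
  have "bl_lip {1..n} (\<lambda>x. g ((\<Sum>i=1..k. x i) / B k))" if "k \<in> {1..n}" for k
    using that
    by (intro bl_lip_mono[OF bl_lip_comp_sum[OF cbl_scale_arg[OF assms]], of "{1..k}"]) auto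
  then have 1: "bl_lip {1..n} \<phi>"
    unfolding \<phi>_def by (intro bl_lip_sum bl_lip_mult bl_lip_const)
  have 2: "log_sum g n \<omega> = \<phi> (\<lambda>i. X i \<omega>)" for \<omega>
    unfolding log_sum_def \<phi>_def Wn_def by simp
  have 3: "\<bar>\<phi> x\<bar> \<le> b * harm n" if "\<And>y. \<bar>g y\<bar> \<le> b" for b x
  proof -
    have "\<bar>\<phi> x\<bar> \<le> (\<Sum>k=1..n. b * (1 / real k))"
      unfolding \<phi>_def
      by (intro order_trans[OF sum_abs] sum_mono) (auto simp: abs_mult that intro: divide_right_mono)
    then show ?thesis
      unfolding harm_def by (simp add: sum_distrib_left inverse_eq_divide)
  qed
  show thesis by (rule that[OF 1 2 3])
qed

lemma log_sum_bounded_rv: "cbl g \<Longrightarrow> bounded_rv (log_sum g n)"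
proof -
  assume "cbl g"
  then obtain \<phi> where "bl_lip {1..n} \<phi>" "\<And>\<omega>. log_sum g n \<omega> = \<phi> (\<lambda>i. X i \<omega>)"
    using log_sum_bl_lip by metis
  then show ?thesis
    using bounded_rv_bl_lip[of "{1..n}" X \<phi>] X_in_H by (simp flip: \<open>\<And>\<omega>. log_sum g n \<omega> = _\<close>)
qed

lemma log_sum_increment:
  assumes "\<And>x. \<bar>g x\<bar> \<le> b" and "m \<le> n"
  shows "\<bar>log_sum g n \<omega> - log_sum g m \<omega>\<bar> \<le> b * (\<Sum>k\<in>{m<..n}. 1 / real k)"
proof -
  have "{1..n} = {1..m} \<union> {m<..n}" "{1..m} \<inter> {m<..n} = {}"
    using assms(2) by auto
  then have "log_sum g n \<omega> - log_sum g m \<omega> = (\<Sum>k\<in>{m<..n}. g (W k \<omega>) / real k)"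
    unfolding log_sum_def by (simp add: sum.union_disjoint)
  also have "\<bar>\<dots>\<bar> \<le> (\<Sum>k\<in>{m<..n}. b * (1 / real k))"
    by (intro order_trans[OF sum_abs] sum_mono) (auto simp: assms(1) intro: divide_right_mono)
  finally show ?thesis
    by (simp add: sum_distrib_left)
qed

text \<open>Only the positive part is controlled: upper expectations bound
  \<open>E\<^sub>P[G g(W\<^sub>n)]\<close> from above for \<open>G \<ge> 0\<close>, so the recursion is run on
  \<open>((x + y)\<^sup>+)\<^sup>2 \<le> (x\<^sup>+)\<^sup>2 + 2 x\<^sup>+ y + y\<^sup>2\<close>, after going back by a factor \<open>2\<^sup>j\<close> in time to
  decorrelate \<open>x\<^sup>+\<close> from \<open>y\<close>.\<close>
lemma log_sum_second_moment:
  assumes g: "L > 0" "b > 0" "\<And>x. \<bar>g x\<bar> \<le> b" "\<And>x y. \<bar>g x - g y\<bar> \<le> L * \<bar>x - y\<bar>"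
      "lim.E (\<lambda>\<omega>. g (\<xi> \<omega>)) \<le> 0"
  obtains C where "C \<ge> 0" "\<And>P j N. \<lbrakk>P \<in> Ps; j \<ge> 1\<rbrakk> \<Longrightarrow>
    (\<integral>\<omega>. (max 0 (log_sum g N \<omega>))\<^sup>2 \<partial>P) \<le>
      harm N * (C * harm N * 2 powr (- (\<alpha> / 2 * real j)) + 2 * b\<^sup>2 * (1 + real j) + b\<^sup>2)"
proof -
  obtain C where C: "C \<ge> 0"
    "\<And>m n g L b G T. \<lbrakk>1 \<le> m; m \<le> n; L > 0; b > 0; \<And>x. \<bar>g x\<bar> \<le> b; \<And>x y. \<bar>g x - g y\<bar> \<le> L * \<bar>x - y\<bar>;
       lim.E (\<lambda>\<omega>. g (\<xi> \<omega>)) \<le> 0; bl_lip {1..m} G; \<And>x. 0 \<le> G x; \<And>x. G x \<le> T\<rbrakk> \<Longrightarrow>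
      E (\<lambda>\<omega>. G (\<lambda>i. X i \<omega>) * g (W n \<omega>)) \<le> C * L * T * (real m / real n) powr (\<alpha> / 2)"
    using weighted_upper_bound by blast
  have cbl: "cbl g"
    using g(3,4) by (rule cblI)
  show thesis
  \<comment> \<open>The 2 comes from the cross term of the square, and \<open>b\<close> from the
    bound \<open>b * harm N\<close> on the weight.\<close>
  proof (rule that[of "2 * C * L * b"])
    show "2 * C * L * b \<ge> 0"
      using C(1) g by simp
    fix P j N assume P: "P \<in> Ps" and j: "(j::nat) \<ge> 1"
    interpret P: prob_space P by (rule prob_space_Ps[OF P])
    define R where "R = (\<lambda>n \<omega>. max 0 (log_sum g n \<omega>))"
    have R0: "R n \<omega> \<ge> 0" for n \<omega>
      unfolding R_def by simp
    have bR: "bounded_rv (R n)" for n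
    proof -
      obtain \<phi> where \<phi>: "bl_lip {1..n} \<phi>" "\<And>\<omega>. log_sum g n \<omega> = \<phi> (\<lambda>i. X i \<omega>)"
        using log_sum_bl_lip[OF cbl] by metis
      show ?thesis
        unfolding R_def \<phi>(2) using X_in_H
        by (intro bounded_rv_bl_lip[OF _ _ bl_lip_max0[OF \<phi>(1)]]) auto
    qed
    have bW: "bounded_rv (\<lambda>\<omega>. g (W n \<omega>))" for n
      by (intro bounded_rv_cbl cbl W_measurable)
    define q where "q = 2 powr (- (\<alpha> / 2 * real j))"
    have q: "q \<ge> 0"
      unfolding q_def by simp
    have hN: "harm N \<ge> (0::real)"
      by (rule harm_nonneg)
    have cov: "(\<integral>\<omega>. R (Suc n div 2 ^ j) \<omega> * g (W (Suc n) \<omega>) \<partial>P) \<le> C * L * (b * harm N) * q"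
      if n: "Suc n \<le> N" for n
    proof (cases "Suc n div 2 ^ j = 0")
      \<comment> \<open>Going back by the factor \<open>2 ^ j\<close> passes the start: the sum
        there is empty and the weight vanishes.\<close>
      case True
      then show ?thesis
        using C(1) g hN q by (simp add: R_def log_sum_def)
    next
      case False
      define m where "m = Suc n div 2 ^ j"
      have m: "1 \<le> m" "m \<le> Suc n"
        using False unfolding m_def by (auto simp: div_le_dividend)
      obtain \<phi> where \<phi>: "bl_lip {1..m} \<phi>" "\<And>\<omega>. log_sum g m \<omega> = \<phi> (\<lambda>i. X i \<omega>)"
        "\<And>x. \<bar>\<phi> x\<bar> \<le> b * harm m"
        using log_sum_bl_lip[OF cbl] g(3) by metis
      have "b * harm m \<le> b * harm N"
        using m n g by (intro mult_left_mono harm_mono) auto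
      then have \<phi>_le: "max 0 (\<phi> x) \<le> b * harm N" for x
        using \<phi>(3)[of x] by (auto simp: abs_le_iff)
      have "(\<integral>\<omega>. R m \<omega> * g (W (Suc n) \<omega>) \<partial>P) \<le> E (\<lambda>\<omega>. R m \<omega> * g (W (Suc n) \<omega>))"
        by (intro integral_le_upper upper_finite_bounded bounded_rv_mult bR bW P)
      also have "\<dots> = E (\<lambda>\<omega>. max 0 (\<phi> (\<lambda>i. X i \<omega>)) * g (W (Suc n) \<omega>))"
        unfolding R_def \<phi>(2) ..
      also have "\<dots> \<le> C * L * (b * harm N) * (real m / real (Suc n)) powr (\<alpha> / 2)"
        by (rule C(2)[OF m g bl_lip_max0[OF \<phi>(1)] _ \<phi>_le]) auto
      also have "(real m / real (Suc n)) powr (\<alpha> / 2) \<le> q"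
      proof -
        have "m * 2 ^ j \<le> Suc n"
          unfolding m_def by (rule div_times_less_eq_dividend)
        then have "real m * 2 ^ j \<le> real (Suc n)"
          by (metis of_nat_le_iff of_nat_mult of_nat_numeral of_nat_power)
        then have "real m / real (Suc n) \<le> 2 powr (- real j)"
          by (simp add: powr_minus powr_realpow field_simps)
        then have "(real m / real (Suc n)) powr (\<alpha> / 2) \<le> (2 powr (- real j)) powr (\<alpha> / 2)"
          using \<alpha> by (intro powr_mono2) auto
        then show ?thesis
          unfolding q_def by (simp add: powr_powr mult.commute)
      qed
      finally show ?thesis
        using C(1) g hN unfolding m_def by (simp add: mult_left_mono)
    qed
    \<comment> \<open>The three terms are the decorrelated cross term, the cost of replacing
      \<open>R n\<close> by \<open>R m\<close> in it, and the square of the new summand. Each enters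
      step \<open>Suc n\<close> with the factor \<open>1 / Suc n\<close>, so they add up to
      \<open>harm n * A\<close>.\<close>
    define A where "A = 2 * (C * L * (b * harm N) * q) + 2 * (b * (b * (1 + real j))) + b\<^sup>2"
    have "(\<integral>\<omega>. (R n \<omega>)\<^sup>2 \<partial>P) \<le> harm n * A" if "n \<le> N" for n
      using that
    proof (induction n)
      case 0
      then show ?case by (simp add: R_def log_sum_def harm_def)
    next
      case (Suc n)
      define m where "m = Suc n div 2 ^ j"
      \<comment> \<open>Here \<open>j \<ge> 1\<close> matters: the earlier time must not exceed
        \<open>n\<close>, the last index before the new summand.\<close>
      have "Suc n div 2 ^ j < Suc n"
        using j one_less_power[of "2::nat" j] by (intro div_less_dividend) auto
      then have mn: "m \<le> n"
        unfolding m_def by simp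
      have "Suc n < 2 ^ j * Suc m"
        unfolding m_def by (simp add: dividend_less_times_div)
      then have sum_le: "(\<Sum>k\<in>{m<..n}. 1 / real k) \<le> 1 + real j"
        by (intro sum_inverse_le_dyadic) simp
      define t where "t = 1 / real (Suc n)"
      have t: "0 \<le> t" "t \<le> 1"
        unfolding t_def by auto
      have pointwise: "(R (Suc n) \<omega>)\<^sup>2 \<le> (R n \<omega>)\<^sup>2 + (2 * t * (R m \<omega> * g (W (Suc n) \<omega>)) +
          (2 * t * (b * (b * (1 + real j))) + t * b\<^sup>2))" for \<omega>
      proof -
        define y where "y = g (W (Suc n) \<omega>)"
        have y: "\<bar>y\<bar> \<le> b"
          unfolding y_def by (rule g(3))
        have "log_sum g (Suc n) \<omega> = log_sum g n \<omega> + t * y"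
          unfolding log_sum_def t_def y_def by simp
        \<comment> \<open>Enlarging the old sum to its positive part only increases the new sum, and
          the absolute value also covers the case where the new positive part is 0.\<close>
        then have "R (Suc n) \<omega> \<le> \<bar>R n \<omega> + t * y\<bar>"
          unfolding R_def by auto
        then have "(R (Suc n) \<omega>)\<^sup>2 \<le> (R n \<omega> + t * y)\<^sup>2"
          using R0[of "Suc n" \<omega>] by (metis power2_abs power_mono)
        also have "\<dots> = (R n \<omega>)\<^sup>2 + 2 * t * (R n \<omega> * y) + t\<^sup>2 * y\<^sup>2"
          by (simp add: power2_eq_square algebra_simps)
        finally have 1: "(R (Suc n) \<omega>)\<^sup>2 \<le> (R n \<omega>)\<^sup>2 + 2 * t * (R n \<omega> * y) + t\<^sup>2 * y\<^sup>2" .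
        have "\<bar>R n \<omega> - R m \<omega>\<bar> \<le> \<bar>log_sum g n \<omega> - log_sum g m \<omega>\<bar>"
          unfolding R_def by (auto simp: max_def)
        also have "\<dots> \<le> b * (\<Sum>k\<in>{m<..n}. 1 / real k)"
          by (rule log_sum_increment[OF g(3) mn])
        also have "\<dots> \<le> b * (1 + real j)"
          using g sum_le by (intro mult_left_mono) auto
        finally have "\<bar>(R n \<omega> - R m \<omega>) * y\<bar> \<le> b * (1 + real j) * b"
          unfolding abs_mult using y g by (intro mult_mono) auto
        then have "R n \<omega> * y \<le> R m \<omega> * y + b * (b * (1 + real j))"
          by (simp add: algebra_simps abs_le_iff)
        then have "2 * t * (R n \<omega> * y) \<le> 2 * t * (R m \<omega> * y + b * (b * (1 + real j)))"
          using t by (intro mult_left_mono) auto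
        then have 2: "2 * t * (R n \<omega> * y) \<le> 2 * t * (R m \<omega> * y) + 2 * t * (b * (b * (1 + real j)))"
          unfolding distrib_left .
        have "t\<^sup>2 \<le> t"
          using t by (simp add: power2_eq_square mult_left_le)
        moreover have "y\<^sup>2 \<le> b\<^sup>2"
          using y g by (metis abs_ge_zero power2_abs power_mono)
        ultimately have "t\<^sup>2 * y\<^sup>2 \<le> t * b\<^sup>2"
          using t by (intro mult_mono) auto
        with 1 2 show ?thesis
          unfolding y_def by linarith
      qed
      have int: "integrable P (\<lambda>\<omega>. (R n \<omega>)\<^sup>2)" "integrable P (\<lambda>\<omega>. R m \<omega> * g (W (Suc n) \<omega>))" for n m
        unfolding power2_eq_square
        by (intro bounded_rv_integrable bounded_rv_mult bR bW P)+
      have "(\<integral>\<omega>. (R (Suc n) \<omega>)\<^sup>2 \<partial>P) \<le> (\<integral>\<omega>. (R n \<omega>)\<^sup>2 + (2 * t * (R m \<omega> * g (W (Suc n) \<omega>)) +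
          (2 * t * (b * (b * (1 + real j))) + t * b\<^sup>2)) \<partial>P)"
        using int by (intro integral_mono pointwise) auto
      also have "\<dots> = (\<integral>\<omega>. (R n \<omega>)\<^sup>2 \<partial>P) + (2 * t * (\<integral>\<omega>. R m \<omega> * g (W (Suc n) \<omega>) \<partial>P) +
          (2 * t * (b * (b * (1 + real j))) + t * b\<^sup>2))"
        using int by (simp add: P.prob_space)
      also have "\<dots> \<le> harm n * A + (2 * t * (C * L * (b * harm N) * q) +
          (2 * t * (b * (b * (1 + real j))) + t * b\<^sup>2))"
        using Suc t g(2) cov[OF Suc.prems] unfolding m_def[symmetric]
        by (intro add_mono mult_left_mono) auto
      also have "\<dots> = (harm n + t) * A"
        unfolding A_def by (simp add: algebra_simps)
      also have "harm n + t = harm (Suc n)"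
        unfolding t_def by (simp add: harm_Suc inverse_eq_divide)
      finally show ?case .
    qed
    from this[of N] show "(\<integral>\<omega>. (max 0 (log_sum g N \<omega>))\<^sup>2 \<partial>P) \<le>
      harm N * (2 * C * L * b * harm N * 2 powr (- (\<alpha> / 2 * real j)) + 2 * b\<^sup>2 * (1 + real j) + b\<^sup>2)"
      unfolding R_def A_def q_def by (simp add: power2_eq_square mult_ac)
  qed
qed

text \<open>At the node \<open>2 ^ (j ^ 3)\<close> the second moment bound is used with the same
  \<open>j\<close>: the exponential factor absorbs the inner \<open>harm\<close>, of order
  \<open>j ^ 3\<close>, and leaves order \<open>j ^ 4\<close>. Markov's inequality against the
  square of \<open>\<epsilon> * j ^ 3\<close> then gives probabilities of order
  \<open>1 / j ^ 2\<close>, which are summable.\<close>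

lemma log_sum_subsequence:
  assumes g: "cbl g" "lim.E (\<lambda>\<omega>. g (\<xi> \<omega>)) \<le> 0" and P: "P \<in> Ps" and \<epsilon>: "\<epsilon> > 0"
  shows "AE \<omega> in P. eventually (\<lambda>j. log_sum g (2 ^ (j ^ 3)) \<omega> \<le> \<epsilon> * real j ^ 3) sequentially"
proof -
  interpret P: prob_space P by (rule prob_space_Ps[OF P])
  obtain b L where bL: "b > 0" "L > 0" "\<And>x. \<bar>g x\<bar> \<le> b" "\<And>x y. \<bar>g x - g y\<bar> \<le> L * \<bar>x - y\<bar>"
    using cblE[OF g(1)] by metis
  obtain C where C: "C \<ge> 0" "\<And>P j N. \<lbrakk>P \<in> Ps; j \<ge> 1\<rbrakk> \<Longrightarrow>
    (\<integral>\<omega>. (max 0 (log_sum g N \<omega>))\<^sup>2 \<partial>P) \<le>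
      harm N * (C * harm N * 2 powr (- (\<alpha> / 2 * real j)) + 2 * b\<^sup>2 * (1 + real j) + b\<^sup>2)"
    using log_sum_second_moment[OF bL(2,1,3,4) g(2)] by metis
  have "(\<lambda>j. (1 + real j ^ 3) * 2 powr (- (\<alpha> / 2 * real j))) \<longlonglongrightarrow> 0"
    using \<alpha> by real_asymp
  then obtain D where D: "\<And>j. norm ((1 + real j ^ 3) * 2 powr (- (\<alpha> / 2 * real j))) \<le> D"
    using convergent_imp_Bseq[of "\<lambda>j. (1 + real j ^ 3) * 2 powr (- (\<alpha> / 2 * real j))"]
    unfolding convergent_def Bseq_def by blast
  have D0: "D \<ge> 0"
    using D[of 0] norm_ge_zero order_trans by blast
  define D' where "D' = 2 * (C * D + 5 * b\<^sup>2)"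
  have moment: "(\<integral>\<omega>. (max 0 (log_sum g (2 ^ (j ^ 3)) \<omega>))\<^sup>2 \<partial>P) \<le> D' * real j ^ 4" if j: "j \<ge> 1" for j
  proof -
    let ?h = "harm (2 ^ (j ^ 3)) :: real"
    have "{0<..n} = {1..n}" for n :: nat by auto
    then have h: "?h \<le> 1 + real j ^ 3"
      using sum_inverse_le_dyadic[of "2 ^ (j ^ 3)" "j ^ 3" 0] unfolding harm_def
      by (simp add: inverse_eq_divide)
    have j1: "1 \<le> real j" "1 \<le> real j ^ 3"
      using j by auto
    have h2: "?h \<le> 2 * real j ^ 3"
      using h j1 by linarith
    have "C * ?h * 2 powr (- (\<alpha> / 2 * real j)) \<le> C * ((1 + real j ^ 3) * 2 powr (- (\<alpha> / 2 * real j)))"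
      unfolding mult.assoc using h C(1) by (intro mult_left_mono mult_right_mono) auto
    also have "\<dots> \<le> C * D"
      using D[of j] C(1) by (intro mult_left_mono) auto
    also have "\<dots> \<le> C * D * real j"
      using C(1) D0 j1 mult_left_mono[of 1 "real j" "C * D"] by simp
    finally have "C * ?h * 2 powr (- (\<alpha> / 2 * real j)) \<le> C * D * real j" .
    moreover have "2 * b\<^sup>2 * (1 + real j) + b\<^sup>2 \<le> 5 * b\<^sup>2 * real j"
      using mult_left_mono[OF j1(1), of "b\<^sup>2"] by (simp add: algebra_simps)
    ultimately have "C * ?h * 2 powr (- (\<alpha> / 2 * real j)) + 2 * b\<^sup>2 * (1 + real j) + b\<^sup>2
        \<le> (C * D + 5 * b\<^sup>2) * real j"
      by (simp add: algebra_simps)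
    then have "?h * (C * ?h * 2 powr (- (\<alpha> / 2 * real j)) + 2 * b\<^sup>2 * (1 + real j) + b\<^sup>2)
        \<le> (2 * real j ^ 3) * ((C * D + 5 * b\<^sup>2) * real j)"
      using h2 C(1) by (intro mult_mono) (auto simp: harm_nonneg)
    also have "\<dots> = D' * real j ^ 4"
      unfolding D'_def by (simp add: power3_eq_cube power4_eq_xxxx)
    finally show ?thesis
      using C(2)[OF P j, of "2 ^ (j ^ 3)"] by linarith
  qed
  define A where "A = (\<lambda>j. {\<omega> \<in> space P. (\<epsilon> * real j ^ 3)\<^sup>2 \<le> (max 0 (log_sum g (2 ^ (j ^ 3)) \<omega>))\<^sup>2})"
  have meas: "log_sum g n \<in> borel_measurable P" for n
    using log_sum_bounded_rv[OF g(1)] bounded_rv_measurable measurable_Ps[OF P] by blast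
  have bd: "bounded_rv (\<lambda>\<omega>. (max 0 (log_sum g n \<omega>))\<^sup>2)" for n
  proof -
    obtain \<phi> where \<phi>: "bl_lip {1..n} \<phi>" "\<And>\<omega>. log_sum g n \<omega> = \<phi> (\<lambda>i. X i \<omega>)"
      using log_sum_bl_lip[OF g(1)] by metis
    show ?thesis
      unfolding \<phi>(2) power2_eq_square using X_in_H
      by (intro bounded_rv_mult bounded_rv_bl_lip[OF _ _ bl_lip_max0[OF \<phi>(1)]]) auto
  qed
  have A: "A j \<in> sets P" for j
    unfolding A_def using meas by measurable
  have "measure P (A j) \<le> D' / \<epsilon>\<^sup>2 * (1 / real j ^ 2)" if j: "j \<ge> 1" for j
  proof -
    have pos: "(\<epsilon> * real j ^ 3)\<^sup>2 > 0"
      using \<epsilon> j by simp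
    have "measure P (A j) \<le> (\<integral>\<omega>. (max 0 (log_sum g (2 ^ (j ^ 3)) \<omega>))\<^sup>2 \<partial>P) / (\<epsilon> * real j ^ 3)\<^sup>2"
      unfolding A_def using pos
      by (intro integral_Markov_inequality_measure[where A = "{}"] bounded_rv_integrable bd P) auto
    also have "\<dots> \<le> D' * real j ^ 4 / (\<epsilon> * real j ^ 3)\<^sup>2"
      using moment[OF j] by (intro divide_right_mono) auto
    also have "\<dots> = D' / \<epsilon>\<^sup>2 * (1 / real j ^ 2)"
      using j \<epsilon> by (simp add: field_simps power_mult_distrib flip: power_mult power_add)
    finally show ?thesis .
  qed
  moreover have "summable (\<lambda>j. D' / \<epsilon>\<^sup>2 * (1 / real j ^ 2))"
    using inverse_power_summable[of 2, where ?'a = real]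
    by (intro summable_mult) (simp add: inverse_eq_divide)
  ultimately have "summable (\<lambda>j. measure P (A j))"
    by (intro summable_comparison_test[of "\<lambda>j. measure P (A j)"]) auto
  then have "AE \<omega> in P. eventually (\<lambda>j. \<omega> \<in> space P - A j) sequentially"
    by (intro borel_cantelli_AE1 A) (auto simp: less_top[symmetric])
  then show ?thesis
  proof eventually_elim
    case (elim \<omega>)
    then show ?case
    proof eventually_elim
      case (elim j)
      then have "(max 0 (log_sum g (2 ^ (j ^ 3)) \<omega>))\<^sup>2 < (\<epsilon> * real j ^ 3)\<^sup>2"
        unfolding A_def by auto
      then have "max 0 (log_sum g (2 ^ (j ^ 3)) \<omega>) < \<epsilon> * real j ^ 3"
        using \<epsilon> by (intro power2_less_imp_less[of "max 0 _"]) auto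
      then show ?case by simp
    qed
  qed
qed

text \<open>Centring at \<open>\<mu>\<close> reduces to the previous bound. The subtracted constant
  returns as \<open>\<mu> * harm n / ln n\<close>, which tends to \<open>\<mu>\<close>; this and the
  centred sum each take half of \<open>\<epsilon>\<close>.\<close>

lemma log_average_upper:
  assumes h: "cbl h" and P: "P \<in> Ps" and \<epsilon>: "\<epsilon> > 0"
  shows "AE \<omega> in P. eventually (\<lambda>n. log_sum h n \<omega> / ln (real n) \<le> lim.E (\<lambda>\<omega>. h (\<xi> \<omega>)) + \<epsilon>) sequentially"
proof -
  define \<mu> where "\<mu> = lim.E (\<lambda>\<omega>. h (\<xi> \<omega>))"
  define g where "g = (\<lambda>x. h x - \<mu>)"
  have g: "cbl g"
    unfolding g_def by (rule cbl_diff_const[OF h])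
  have g0: "lim.E (\<lambda>\<omega>. g (\<xi> \<omega>)) \<le> 0"
    using lim.upper_add_const[OF lim.bounded_rv_cbl[OF h \<xi>_measurable], of "- \<mu>"]
    unfolding g_def \<mu>_def by simp
  obtain b where b: "b > 0" "\<And>x. \<bar>g x\<bar> \<le> b"
    using cblE[OF g] by metis
  have "((\<lambda>n. \<mu> * (harm n / ln (real n))) \<longlongrightarrow> \<mu> * 1) sequentially"
    by (intro tendsto_mult tendsto_const harm_div_ln)
  then have lim: "eventually (\<lambda>n. \<mu> * (harm n / ln (real n)) < \<mu> + \<epsilon> / 2) sequentially"
    using \<epsilon> by (intro order_tendstoD(2)[of _ "\<mu> * 1"]) auto
  \<comment> \<open>The quarter is the one that \<open>interpolate_log_growth\<close> asks for at
    level \<open>\<epsilon> / 2\<close>.\<close>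
  have "\<epsilon> / 2 / 4 > 0"
    using \<epsilon> by simp
  from log_sum_subsequence[OF g g0 P this] show ?thesis
  proof eventually_elim
    case (elim \<omega>)
    have "eventually (\<lambda>n. log_sum g n \<omega> \<le> \<epsilon> / 2 * ln (real n)) sequentially"
      using \<epsilon> by (intro interpolate_log_growth[OF log_sum_increment[OF b(2)] b(1) _ elim]) auto
    with lim eventually_gt_at_top[of 1] show ?case
    proof eventually_elim
      case (elim n)
      have "log_sum h n \<omega> = log_sum g n \<omega> + \<mu> * harm n"
        unfolding log_sum_def g_def harm_def
        by (simp add: diff_divide_distrib sum_subtractf sum_distrib_left inverse_eq_divide)
      then have "log_sum h n \<omega> / ln (real n) = log_sum g n \<omega> / ln (real n) + \<mu> * (harm n / ln (real n))"
        by (simp add: add_divide_distrib)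
      moreover have "log_sum g n \<omega> / ln (real n) \<le> \<epsilon> / 2"
        using elim by (simp add: field_simps)
      ultimately show ?case
        using elim unfolding \<mu>_def by linarith
    qed
  qed
qed

end

section \<open>A countable family of upper envelopes\<close>

text \<open>An \<open>L\<close>-Lipschitz function bounded by \<open>b\<close> lies below every such envelope whose nodes
  \<open>(y, q)\<close> lie above its graph. Since the approximation is from above on the whole line, no
  tightness of the logarithmic averages is needed to pass from the envelopes to the function.\<close>
fun envelope :: "(rat \<times> rat) list \<Rightarrow> nat \<Rightarrow> nat \<Rightarrow> real \<Rightarrow> real" where
  "envelope [] L b x = real b"
| "envelope ((y, q) # ps) L b x = min (of_rat q + real L * \<bar>x - of_rat y\<bar>) (envelope ps L b x)"

lemma envelope_le_bound: "envelope ps L b x \<le> real b"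
  by (induction ps L b x rule: envelope.induct) auto

lemma envelope_le_node: "(y, q) \<in> set ps \<Longrightarrow> envelope ps L b x \<le> of_rat q + real L * \<bar>x - of_rat y\<bar>"
  by (induction ps L b x rule: envelope.induct) (auto simp: min_le_iff_disj)

lemma envelope_ge:
  assumes "\<And>y q. (y, q) \<in> set ps \<Longrightarrow> f (of_rat y) \<le> of_rat q"
    and "\<And>x y. \<bar>f x - f y\<bar> \<le> real L * \<bar>x - y\<bar>" and "\<And>x. f x \<le> real b"
  shows "f x \<le> envelope ps L b x"
  using assms(1)
proof (induction ps)
  case Nil
  then show ?case by (simp add: assms(3))
next
  case (Cons p ps)
  obtain y q where p: "p = (y, q)" by (cases p)
  have "f (of_rat y) \<le> of_rat q"
    by (rule Cons.prems) (simp add: p)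
  then have "f x \<le> of_rat q + real L * \<bar>x - of_rat y\<bar>"
    using assms(2)[of x "of_rat y"] by (simp add: abs_le_iff)
  then show ?case
    using Cons unfolding p by auto
qed

lemma cbl_envelope: "cbl (envelope ps L b)"
proof -
  have "\<bar>envelope ps L b x - envelope ps L b y\<bar> \<le> real L * \<bar>x - y\<bar>" for x y
  proof (induction ps)
    case (Cons p ps)
    obtain z q where p: "p = (z, q)" by (cases p)
    have "real L * \<bar>\<bar>x - of_rat z\<bar> - \<bar>y - of_rat z\<bar>\<bar> \<le> real L * \<bar>x - y\<bar>"
      by (intro mult_left_mono) auto
    then have "\<bar>real L * \<bar>x - of_rat z\<bar> - real L * \<bar>y - of_rat z\<bar>\<bar> \<le> real L * \<bar>x - y\<bar>"
      by (simp add: abs_mult flip: right_diff_distrib)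
    then show ?case
      using Cons unfolding p by (auto simp: min_def abs_le_iff)
  qed simp
  moreover have "\<exists>c. \<forall>x. c \<le> envelope ps L b x"
  proof (induction ps)
    case (Cons p ps)
    obtain z q where p: "p = (z, q)" by (cases p)
    obtain c where "\<forall>x. c \<le> envelope ps L b x"
      using Cons by blast
    then have "\<forall>x. min c (of_rat q) \<le> envelope (p # ps) L b x"
      unfolding p by (auto simp: min_le_iff_disj intro: add_increasing2)
    then show ?case by blast
  qed auto
  then obtain c where c: "\<And>x. c \<le> envelope ps L b x" by blast
  have "\<bar>envelope ps L b x\<bar> \<le> \<bar>c\<bar> + real b" for x
    using envelope_le_bound[of ps L b x] c[of x] of_nat_0_le_iff[of b, where ?'a = real]
    unfolding abs_le_iff by linarith
  ultimately show ?thesis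
    by (intro cblI)
qed

lemma envelope_approx:
  assumes f: "\<And>x. \<bar>f x\<bar> \<le> real b" "\<And>x y. \<bar>f x - f y\<bar> \<le> real L * \<bar>x - y\<bar>" and \<delta>: "\<delta> > 0"
  obtains ps where "\<And>x. f x \<le> envelope ps L b x" "\<And>x. \<bar>x\<bar> \<le> real r \<Longrightarrow> envelope ps L b x \<le> f x + \<delta>"
proof -
  \<comment> \<open>With mesh \<open>1 / N\<close>, slope times mesh is at most
    \<open>\<delta> / 4\<close>. This is paid twice, for the envelope and for \<open>f\<close>; the
    rational heights take the other \<open>\<delta> / 2\<close>.\<close>
  obtain N :: nat where N: "N > 0" "4 * real L / \<delta> < real N"
  proof -
    obtain N :: nat where N: "4 * real L / \<delta> < real N"
      using reals_Archimedean2 by blast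
    moreover have "0 \<le> 4 * real L / \<delta>"
      using \<delta> by simp
    ultimately have "0 < real N"
      by linarith
    with N show thesis
      using that by simp
  qed
  define y :: "int \<Rightarrow> rat" where "y = (\<lambda>i. of_int i / of_nat N)"
  have y: "real_of_rat (y i) = of_int i / real N" for i
    unfolding y_def by (simp add: of_rat_divide)
  have "\<exists>q. f (of_rat (y i)) < of_rat q \<and> of_rat q < f (of_rat (y i)) + \<delta> / 2" for i
    using of_rat_dense[of "f (of_rat (y i))" "f (of_rat (y i)) + \<delta> / 2"] \<delta> by auto
  then obtain q where q: "\<And>i. f (of_rat (y i)) < of_rat (q i)" "\<And>i. of_rat (q i) < f (of_rat (y i)) + \<delta> / 2"
    by metis
  define ps where "ps = map (\<lambda>i. (y i, q i)) [- int (r * N)..int (r * N)]"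
  show thesis
  proof (rule that[of ps])
    show "f x \<le> envelope ps L b x" for x
    proof (rule envelope_ge[OF _ f(2)])
      show "f x \<le> real b" for x
        using f(1)[of x] by simp
      show "f (of_rat z) \<le> of_rat p" if "(z, p) \<in> set ps" for z p
        using that q(1) unfolding ps_def by (auto intro: less_imp_le)
    qed
    fix x assume x: "\<bar>x\<bar> \<le> real r"
    define i where "i = \<lfloor>x * real N\<rfloor>"
    have "\<bar>x * real N\<bar> \<le> real r * real N"
      using x by (simp add: abs_mult mult_right_mono)
    then have "- of_int (int (r * N)) \<le> x * real N" "x * real N \<le> of_int (int (r * N))"
      by (auto simp: abs_le_iff)
    then have "- int (r * N) \<le> i" "i \<le> int (r * N)"
      unfolding i_def by (auto simp: le_floor_iff floor_le_iff)
    then have mem: "(y i, q i) \<in> set ps"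
      unfolding ps_def by auto
    have "of_int i \<le> x * real N" "x * real N < of_int i + 1"
      unfolding i_def by linarith+
    then have "\<bar>x * real N - of_int i\<bar> / real N \<le> 1 / real N"
      by (intro divide_right_mono) auto
    moreover have "x - of_int i / real N = (x * real N - of_int i) / real N"
      using N(1) by (simp add: field_simps)
    ultimately have "\<bar>x - of_rat (y i)\<bar> \<le> 1 / real N"
      unfolding y by simp
    then have "real L * \<bar>x - of_rat (y i)\<bar> \<le> real L * (1 / real N)"
      by (intro mult_left_mono) auto
    also have "\<dots> \<le> \<delta> / 4"
      using N \<delta> by (simp add: field_simps)
    finally have d: "real L * \<bar>x - of_rat (y i)\<bar> \<le> \<delta> / 4" .
    have "envelope ps L b x \<le> of_rat (q i) + real L * \<bar>x - of_rat (y i)\<bar>"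
      by (rule envelope_le_node[OF mem])
    also have "\<dots> \<le> f x + \<delta>"
      using q(2)[of i] f(2)[of x "of_rat (y i)"] d by (simp add: abs_le_iff)
    finally show "envelope ps L b x \<le> f x + \<delta>" .
  qed
qed

section \<open>One event for all test functions\<close>

context song_clt
begin

text \<open>The envelope is close to \<open>f\<close> only on \<open>[-r, r]\<close>. Outside, the
  excess is at most \<open>2 * b\<close>, hence at most \<open>2 * b * (x / r)^2\<close>, whose
  upper expectation at \<open>\<xi>\<close> is small for large \<open>r\<close> because the second
  moment is finite.\<close>

lemma envelope_upper_exp_approx:
  assumes f: "cbl f" and \<epsilon>: "\<epsilon> > 0"
  obtains ps L b where "\<And>x. f x \<le> envelope ps L b x"
    "lim.E (\<lambda>\<omega>. envelope ps L b (\<xi> \<omega>)) \<le> lim.E (\<lambda>\<omega>. f (\<xi> \<omega>)) + \<epsilon>"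
proof -
  obtain B' L' where BL: "\<And>x. \<bar>f x\<bar> \<le> B'" "\<And>x y. \<bar>f x - f y\<bar> \<le> L' * \<bar>x - y\<bar>"
    using cblE[OF f] by metis
  obtain b L :: nat where b: "B' \<le> real b" and L: "L' \<le> real L"
    by (meson real_arch_simple)
  have fb: "\<bar>f x\<bar> \<le> real b" for x
    using BL(1)[of x] b by linarith
  have fL: "\<bar>f x - f y\<bar> \<le> real L * \<bar>x - y\<bar>" for x y
    by (rule order_trans[OF BL(2)]) (intro mult_right_mono L, simp)
  define V where "V = lim.E (\<lambda>\<omega>. (\<xi> \<omega>)\<^sup>2)"
  have V: "V \<ge> 0"
    unfolding V_def by (intro lim.upper_nonneg \<xi>_square) auto
  \<comment> \<open>The extra 1 forces \<open>r \<ge> 1\<close>, so that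
    \<open>r \<le> r * r\<close> and a linear lower bound on \<open>r\<close> controls its
    square.\<close>
  obtain r :: nat where r0: "4 * real b * V / \<epsilon> + 1 < real r"
    using reals_Archimedean2 by blast
  have r1: "real r \<ge> 1"
  proof -
    have "0 \<le> 4 * real b * V / \<epsilon>"
      using V \<epsilon> by simp
    then show ?thesis
      using r0 by linarith
  qed
  have "4 * real b * V / \<epsilon> \<le> real r * real r"
    using r0 mult_left_mono[OF r1, of "real r"] by linarith
  then have r: "2 * real b / (real r)\<^sup>2 * V \<le> \<epsilon> / 2"
    using r1 \<epsilon> by (simp add: field_simps power2_eq_square)
  have "\<epsilon> / 2 > 0" using \<epsilon> by simp
  from envelope_approx[OF fb fL this, where r = r]
  obtain ps where ps: "\<And>x. f x \<le> envelope ps L b x"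
    "\<And>x. \<bar>x\<bar> \<le> real r \<Longrightarrow> envelope ps L b x \<le> f x + \<epsilon> / 2"
    by metis
  define c where "c = 2 * real b / (real r)\<^sup>2"
  have c: "c \<ge> 0"
    unfolding c_def by simp
  have le: "envelope ps L b x \<le> f x + \<epsilon> / 2 + c * x\<^sup>2" for x
  proof (cases "\<bar>x\<bar> \<le> real r")
    case True
    then show ?thesis
      using ps(2)[OF True] mult_nonneg_nonneg[OF c zero_le_power2[of x]] by linarith
  next
    case False
    then have "(real r)\<^sup>2 \<le> x\<^sup>2"
      using power_mono[of "real r" "\<bar>x\<bar>" 2] by simp
    then have "c * (real r)\<^sup>2 \<le> c * x\<^sup>2"
      using c by (intro mult_left_mono)
    moreover have "c * (real r)\<^sup>2 = 2 * real b"
      unfolding c_def using r1 by simp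
    ultimately show ?thesis
      using envelope_le_bound[of ps L b x] fb[of x] \<epsilon> by (simp add: abs_le_iff)
  qed
  have bf: "lim.bounded_rv (\<lambda>\<omega>. f (\<xi> \<omega>))"
    by (intro lim.bounded_rv_cbl f \<xi>_measurable)
  have fin1: "upper_finite Ps' (\<lambda>\<omega>. f (\<xi> \<omega>) + \<epsilon> / 2)"
    by (intro lim.upper_finite_bounded lim.bounded_rv_add lim.bounded_rv_const bf)
  have fin2: "upper_finite Ps' (\<lambda>\<omega>. c * (\<xi> \<omega>)\<^sup>2)"
    by (intro lim.upper_finite_cmult \<xi>_square c)
  have "lim.E (\<lambda>\<omega>. envelope ps L b (\<xi> \<omega>)) \<le> lim.E (\<lambda>\<omega>. f (\<xi> \<omega>) + \<epsilon> / 2 + c * (\<xi> \<omega>)\<^sup>2)"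
    by (intro lim.upper_mono lim.bounded_rv_cbl cbl_envelope \<xi>_measurable lim.upper_finite_add fin1 fin2 le)
  also have "\<dots> \<le> lim.E (\<lambda>\<omega>. f (\<xi> \<omega>) + \<epsilon> / 2) + lim.E (\<lambda>\<omega>. c * (\<xi> \<omega>)\<^sup>2)"
    by (intro lim.upper_add fin1 fin2)
  also have "\<dots> = lim.E (\<lambda>\<omega>. f (\<xi> \<omega>)) + \<epsilon> / 2 + c * V"
    unfolding V_def by (simp add: lim.upper_add_const[OF bf] lim.upper_cmult[OF \<xi>_square c])
  also have "\<dots> \<le> lim.E (\<lambda>\<omega>. f (\<xi> \<omega>)) + \<epsilon>"
    using r unfolding c_def by simp
  finally show thesis
    using that ps(1) by blast
qed

text \<open>All quantifiers run over countable types, with \<open>1 / Suc p\<close> in place of a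
  real tolerance. Hence the event is measurable, and almost sure statements combine into
  one.\<close>

definition good_event :: "'a set" where
  "good_event = {\<omega> \<in> space M. \<forall>ps L b p. eventually (\<lambda>n. log_sum (envelope ps L b) n \<omega> / ln (real n)
      \<le> lim.E (\<lambda>\<omega>. envelope ps L b (\<xi> \<omega>)) + 1 / real (Suc p)) sequentially}"

lemma good_event_measurable: "good_event \<in> sets M"
proof -
  have [measurable]: "log_sum (envelope ps L b) n \<in> borel_measurable M" for ps L b n
    by (intro bounded_rv_measurable log_sum_bounded_rv cbl_envelope)
  show ?thesis
    unfolding good_event_def eventually_sequentially by measurable
qed

text \<open>The event is chosen independently of \<open>P\<close> and has probability one under each
  \<open>P\<close>, so the infimum is taken over the constant 1.\<close>

lemma lower_cap_good_event: "lower_cap Ps good_event = 1"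
proof -
  have "measure P good_event = 1" if P: "P \<in> Ps" for P
  proof -
    interpret P: prob_space P by (rule prob_space_Ps[OF P])
    have "AE \<omega> in P. \<forall>ps L b p. eventually (\<lambda>n. log_sum (envelope ps L b) n \<omega> / ln (real n)
      \<le> lim.E (\<lambda>\<omega>. envelope ps L b (\<xi> \<omega>)) + 1 / real (Suc p)) sequentially"
      unfolding AE_all_countable by (intro allI log_average_upper cbl_envelope P) simp
    then have "AE \<omega> in P. \<omega> \<in> good_event"
      unfolding good_event_def by (auto simp flip: space_Ps[OF P])
    then show ?thesis
      using good_event_measurable by (subst P.prob_eq_1) (auto simp: sets_Ps[OF P])
  qed
  then have "(\<lambda>P. measure P good_event) ` Ps = {1}"
    using Ps_nonempty by force
  then show ?thesis
    unfolding lower_cap_def by simp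
qed

text \<open>The passage from countably many envelopes to arbitrary \<open>f\<close> is pathwise:
  \<open>f\<close> lies below an envelope at every point, so its logarithmic averages do
  too.\<close>

lemma good_event_upper:
  assumes \<omega>: "\<omega> \<in> good_event" and f: "cbl f" and \<epsilon>: "\<epsilon> > 0"
  shows "eventually (\<lambda>n. log_sum f n \<omega> / ln (real n) \<le> lim.E (\<lambda>\<omega>. f (\<xi> \<omega>)) + \<epsilon>) sequentially"
proof -
  obtain ps L b where ps: "\<And>x. f x \<le> envelope ps L b x"
    "lim.E (\<lambda>\<omega>. envelope ps L b (\<xi> \<omega>)) \<le> lim.E (\<lambda>\<omega>. f (\<xi> \<omega>)) + \<epsilon> / 2"
    using envelope_upper_exp_approx[OF f, of "\<epsilon> / 2"] \<epsilon> by auto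
  obtain p where p: "1 / real (Suc p) < \<epsilon> / 2"
    using nat_approx_posE[of "\<epsilon> / 2"] \<epsilon> by auto
  have "eventually (\<lambda>n. log_sum (envelope ps L b) n \<omega> / ln (real n)
      \<le> lim.E (\<lambda>\<omega>. envelope ps L b (\<xi> \<omega>)) + 1 / real (Suc p)) sequentially"
    using \<omega> unfolding good_event_def by blast
  with eventually_gt_at_top[of 1] show ?thesis
  proof eventually_elim
    case (elim n)
    have "log_sum f n \<omega> \<le> log_sum (envelope ps L b) n \<omega>"
      unfolding log_sum_def by (intro sum_mono divide_right_mono ps(1)) auto
    then have "log_sum f n \<omega> / ln (real n) \<le> log_sum (envelope ps L b) n \<omega> / ln (real n)"
      using elim by (intro divide_right_mono) auto
    then show ?case
      using elim ps(2) p by linarith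
  qed
qed

text \<open>The upper bound for \<open>- f\<close> is a lower bound for \<open>f\<close>, and
  membership in \<open>Hset\<close> makes the two limits coincide.\<close>

lemma good_event_limit:
  assumes \<omega>: "\<omega> \<in> good_event" and f: "f \<in> Hset Ps' \<xi>"
  shows "(\<lambda>n. log_sum f n \<omega> / ln (real n)) \<longlonglongrightarrow> lim.E (\<lambda>\<omega>. f (\<xi> \<omega>))"
proof (rule tendstoI)
  fix \<epsilon> :: real assume \<epsilon>: "\<epsilon> > 0"
  have cbl: "cbl f" and sym: "lim.E (\<lambda>\<omega>. f (\<xi> \<omega>)) = - lim.E (\<lambda>\<omega>. - f (\<xi> \<omega>))"
    using f unfolding Hset_def by auto
  have "\<epsilon> / 2 > 0" using \<epsilon> by simp
  from good_event_upper[OF \<omega> cbl this] good_event_upper[OF \<omega> cbl_uminus[OF cbl] this]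
  show "eventually (\<lambda>n. dist (log_sum f n \<omega> / ln (real n)) (lim.E (\<lambda>\<omega>. f (\<xi> \<omega>))) < \<epsilon>) sequentially"
  proof eventually_elim
    case (elim n)
    have "log_sum (\<lambda>x. - f x) n \<omega> / ln (real n) = - (log_sum f n \<omega> / ln (real n))"
      unfolding log_sum_def by (simp add: sum_negf)
    with elim sym \<epsilon> show ?case
      unfolding dist_real_def abs_less_iff by linarith
  qed
qed

end

theorem theorem4p2:
  fixes M :: "'a measure" and H :: "('a \<Rightarrow> real) set" and Ps :: "'a measure set"
    and M' :: "'b measure" and H' :: "('b \<Rightarrow> real) set" and Ps' :: "'b measure set"
    and X :: "nat \<Rightarrow> 'a \<Rightarrow> real" and \<xi> :: "'b \<Rightarrow> real" and \<beta> \<alpha> :: real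
  assumes "sublin_space M H Ps" and "sublin_space M' H' Ps'"
    and "\<beta> \<ge> 1"
    and "admissible H Ps \<beta> X"
    and "cond_A H Ps" and "cond_A H' Ps'"
    and "\<xi> \<in> H'" and "G_normal Ps' \<xi>"
    and "sqrt (upper_exp Ps' (\<lambda>\<omega>. (\<xi> \<omega>)\<^sup>2)) = 2 * \<beta> / (1 + \<beta>)"
    and "sqrt (- upper_exp Ps' (\<lambda>\<omega>. - (\<xi> \<omega>)\<^sup>2)) = 2 / (1 + \<beta>)"
    and "0 < \<alpha>" and "\<alpha> < 1" and "song_bound H Ps Ps' \<xi> \<beta> \<alpha>"
    and "moment_bdd Ps X (2 + \<alpha>)"
  shows "\<exists>A\<in>sets M.
           A \<subseteq> {\<omega>\<in>space M. \<forall>f\<in>Hset Ps' \<xi>.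
                  (\<lambda>n. (\<Sum>k=1..n. f (Wn Ps X k \<omega>) / real k) / ln (real n))
                    \<longlonglongrightarrow> upper_exp Ps' (\<lambda>\<omega>'. f (\<xi> \<omega>'))}
           \<and> lower_cap Ps A = 1"
proof -
  have "upper_finite Ps' (\<lambda>\<omega>. (\<xi> \<omega>)\<^sup>2)"
    using assms(8) unfolding G_normal_def by blast
  with assms interpret song_clt M H Ps M' H' Ps' X \<xi> \<beta> \<alpha>
    by unfold_locales
  \<comment> \<open>The limit event intersects over all of \<open>Hset\<close>, which may be
    uncountable; \<open>good_event\<close> is a measurable set inside it.\<close>
  have "good_event \<subseteq> {\<omega>\<in>space M. \<forall>f\<in>Hset Ps' \<xi>.
                  (\<lambda>n. (\<Sum>k=1..n. f (Wn Ps X k \<omega>) / real k) / ln (real n))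
                    \<longlonglongrightarrow> upper_exp Ps' (\<lambda>\<omega>'. f (\<xi> \<omega>'))}"
    using good_event_limit unfolding log_sum_def by (auto simp: good_event_def)
  then show ?thesis
    using good_event_measurable lower_cap_good_event by blast
qed

end
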